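(* For every integer $r\ge2$ there is an injection $$\Theta_r:\{(U,U)\}\times\mathcal C_r\hookrightarrow\mathcal C_{r-1},\qquad (U,U,\alpha,\beta)\mapsto(\alpha',\beta'),$$ given as follows. For $(\alpha,\beta)\in\mathcal C_r$, write $\beta=\delta_r\sqcup\gamma$ with $\gamma\in\mathcal M_r$, and let $\lambda=\mathsf K_r(\gamma)\in\mathcal F_r$. Then $\alpha'$ is determined by $$\mathsf B_r(\alpha,\widehat r,\lambda)=(\alpha',\mu),\qquad \mu\in\mathcal F_{r-1},$$ and $\beta'=\delta_{r-1}\sqcup\gamma'$ with $\gamma'=\mathsf K_{r-1}^{-1}(\mu)\in\mathcal M_{r-1}$. This injection satisfies $$|\alpha'|+|\beta'|=|\alpha|+|\beta|,\qquad \ell(\alpha')-\ell(\beta')=\ell(\alpha)-\ell(\beta)+2.$$ Consequently, $$z^2C_r(z,q)\preceq C_{r-1}(z,q).$$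
   Context: $\mathcal P$ is the set of all integer partitions, including the empty one. For $\lambda\in\mathcal P$, $|\lambda|$, $\ell(\lambda)$ and $m_t(\lambda)$ denote the size, the number of parts, and the multiplicity of the part $t$; $\sqcup$ denotes multiset union of parts; $(t)$ is the one-part partition. $\delta_r=(r,r-1,\dots,1)$, $\delta_0=\varnothing$. Minimal excludants: $\operatorname{mex}(\lambda)=\min\{t\ge1:m_t(\lambda)=0\}$ and $\operatorname{mex}_r(\lambda)=\min\{t>r:m_t(\lambda)=0\}$. Frobenius symbol: if $d=\max\{i\ge 1:\lambda_i\ge i\}$ is the Durfee square size and $\lambda'$ the conjugate of $\lambda$, the Frobenius symbol of $\lambda$ has top row $a_i=\lambda_i-i$ and bottom row $b_i=\lambda_i'-i$ ($1\le i\le d$), both strictly decreasing sequences of nonnegative integers; a partition is determined by its Frobenius symbol. $\operatorname{Top}(\lambda)=\{a_1,\dots,a_d\}$, $\operatorname{Top}(\varnothing)=\varnothing$. For $r\ge0$: $\mathcal M_r=\{\lambda\in\mathcal P:\operatorname{mex}_r(\lambda)-r\text{ is odd}\}$ and $\mathcal F_r=\{\lambda\in\mathcal P:r\notin\operatorname{Top}(\lambda)\}$. For $r\ge1$: $\mathcal C_r=\{(\alpha,\beta)\in\mathcal P^2:\operatorname{mex}(\beta)=r+2d+1\text{ for some integer }d\ge0\}$ and $C_r(z,q)=\sum_{(\alpha,\beta)\in\mathcal C_r}q^{|\alpha|+|\beta|}z^{\ell(\alpha)-\ell(\beta)}\in\mathbb Z[z,z^{-1}][[q]]$. For series $F,G\in\mathbb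 Z[z,z^{-1}][[q]]$, $G\preceq F$ means that every coefficient of $F-G$ is nonnegative. $U$ is a formal symbol (an "atom" of weight $z$); $\widehat r$ is a formal symbol (a marked part of size $r$). The map $\mathsf U_r$ ($r\ge2$): for $\lambda\in\mathcal F_r$ with $r-1\in\operatorname{Top}(\lambda)$, $\mathsf U_r(\lambda)$ is the partition whose Frobenius symbol is obtained from that of $\lambda$ by replacing the top-row entry $r-1$ by $r$ and leaving the bottom row unchanged. The map $\mathsf B_r:\mathcal P\times\{\widehat r\}\times\mathcal F_r\to\mathcal P\times\mathcal F_{r-1}$ ($r\ge2$): $\mathsf B_r(\alpha,\widehat r,\lambda)=(\alpha\sqcup(r),\lambda)$ if $r-1\notin\operatorname{Top}(\lambda)$, and $\mathsf B_r(\alpha,\widehat r,\lambda)=(\alpha\sqcup(r-1),\mathsf U_r(\lambda))$ if $r-1\in\operatorname{Top}(\lambda)$. Konan's bijection: for $r\ge0$, $\mathsf K_r:\mathcal M_r\to\mathcal F_r$ is a bijection, due to Konan (known result), with $|\mathsf K_r(\lambda)|=|\lambda|$ and $\ell(\mathsf K_r(\lambda))=\ell(\lambda)$. It is defined as follows. Put $\Delta_{r,t}=(r+t,r+t-1,\dots,r+1)$, $\Delta_{r,0}=\varnothing$. For a partition $\lambda$, with $\lambda_0=\infty$, put $d_s(\lambda)=\max\{i\in\{0,1,\dots,\ell(\lambda)\}:\lambda_i-i\ge s\}$. Given $\gamma\in\mathcal M_r$, write $\operatorname{mex}_r(\gamma)=r+2t+1$ and $\gamma=\Delta_{r,2t}\sqcup\lambda$,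 and start from the state $(\Delta_{r,2t},\lambda)$. At a state $(\Delta_{r,2t},\lambda)$ set $s=r+2t$, $d=d_s(\lambda)$ and apply: (K1) if $s\in\operatorname{Top}(\lambda)$ (so $\lambda_d=d+s$): keep $\Delta_{r,2t}$, delete the part $\lambda_d=d+s$ from $\lambda$, add $1$ to each of the first $d-1$ parts, and insert a part $s+1$; (K2) if $s\notin\operatorname{Top}(\lambda)$ and $t\ge1$: replace $\Delta_{r,2t}$ by $\Delta_{r,2t-2}$, subtract $1$ from each of the first $d$ parts of $\lambda$, and insert parts $d+s$ and $s-1$. In both cases parts are reordered into weakly decreasing order. The iteration terminates at a state $(\Delta_{r,0},\nu)$ with $r\notin\operatorname{Top}(\nu)$, and $\mathsf K_r(\gamma)=\nu$. *)

theory Defs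
  imports
    "HOL-Library.Multiset"
    "HOL-Library.Poly_Mapping"
    "HOL-Library.While_Combinator"
    "HOL-Computational_Algebra.Formal_Power_Series"
begin

section \<open>Integer partitions\<close>

text \<open>A partition is the finite multiset of its parts, which are positive. For a partition
  \<open>\<nu>\<close> one has $|\nu|$ = \<open>sum_mset \<nu>\<close>, $\ell(\nu)$ = \<open>size \<nu>\<close> and
  $m_t(\nu)$ = \<open>count \<nu> t\<close>; multiset union of parts is \<open>+\<close>.\<close>

type_synonym ptn = "nat multiset"

definition partitions :: "ptn set" where
  "partitions = {\<nu>. 0 \<notin># \<nu>}"

definition parts_list :: "ptn \<Rightarrow> nat list" where
  "parts_list \<nu> = rev (sorted_list_of_multiset \<nu>)"

text \<open>\<open>ith_part \<nu> i\<close> is $\nu_i$, counted from \<open>i = 1\<close>; it is only meant for \<open>1 \<le> i\<close>,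
  and it is \<open>0\<close> for \<open>i > size \<nu>\<close>.\<close>

definition ith_part :: "ptn \<Rightarrow> nat \<Rightarrow> nat" where
  "ith_part \<nu> i = (if 1 \<le> i \<and> i \<le> size \<nu> then parts_list \<nu> ! (i - 1) else 0)"

definition conjugate :: "ptn \<Rightarrow> ptn" where
  "conjugate \<nu> = {# size {# x \<in># \<nu>. j \<le> x #}. j \<in># mset_set {1..ith_part \<nu> 1} #}"

definition staircase :: "nat \<Rightarrow> ptn" where
  "staircase r = mset_set {1..r}"

definition mex :: "ptn \<Rightarrow> nat" where
  "mex \<nu> = (LEAST t. 1 \<le> t \<and> count \<nu> t = 0)"

definition mex_above :: "nat \<Rightarrow> ptn \<Rightarrow> nat" where
  "mex_above r \<nu> = (LEAST t. r < t \<and> count \<nu> t = 0)"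

section \<open>Frobenius symbols\<close>

text \<open>The empty partition has Durfee size \<open>0\<close> and the empty Frobenius symbol.\<close>

definition durfee :: "ptn \<Rightarrow> nat" where
  "durfee \<nu> = Max {i \<in> {0..size \<nu>}. i = 0 \<or> i \<le> ith_part \<nu> i}"

definition frobenius :: "ptn \<Rightarrow> nat list \<times> nat list" where
  "frobenius \<nu> =
    (map (\<lambda>i. ith_part \<nu> i - i) [1..<durfee \<nu> + 1],
     map (\<lambda>i. ith_part (conjugate \<nu>) i - i) [1..<durfee \<nu> + 1])"

definition Top :: "ptn \<Rightarrow> nat set" where
  "Top \<nu> = set (fst (frobenius \<nu>))"

definition mex_ptns :: "nat \<Rightarrow> ptn set" where
  "mex_ptns r = {\<nu> \<in> partitions. odd (mex_above r \<nu> - r)}"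

definition frob_ptns :: "nat \<Rightarrow> ptn set" where
  "frob_ptns r = {\<nu> \<in> partitions. r \<notin> Top \<nu>}"

section \<open>Konan's bijection\<close>

definition Delta :: "nat \<Rightarrow> nat \<Rightarrow> ptn" where
  "Delta r t = mset_set {r + 1..r + t}"

text \<open>$d_s(\nu) = \max \{i \in \{0, \dots, \ell(\nu)\} : \nu_i - i \ge s\}$
  with the convention $\nu_0 = \infty$.\<close>

definition konan_d :: "nat \<Rightarrow> ptn \<Rightarrow> nat" where
  "konan_d s \<nu> = Max {i \<in> {0..size \<nu>}. i = 0 \<or> s + i \<le> ith_part \<nu> i}"

text \<open>The state $(\Delta_{r,2t}, \nu)$ is encoded as the pair \<open>(t, \<nu>)\<close>. A step is either (K1)
  or (K2). In (K1) the list \<open>drop d xs\<close> starts after the deleted part $\nu_d = d + s$.\<close>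

definition konan_K1 :: "nat \<Rightarrow> nat \<times> ptn \<Rightarrow> nat \<times> ptn" where
  "konan_K1 r = (\<lambda>(t, \<nu>).
    let s = r + 2 * t; d = konan_d s \<nu>; xs = parts_list \<nu>
    in (t, mset (map (\<lambda>x. x + 1) (take (d - 1) xs)) + mset (drop d xs) + {# s + 1 #}))"

definition konan_K2 :: "nat \<Rightarrow> nat \<times> ptn \<Rightarrow> nat \<times> ptn" where
  "konan_K2 r = (\<lambda>(t, \<nu>).
    let s = r + 2 * t; d = konan_d s \<nu>; xs = parts_list \<nu>
    in (t - 1, mset (map (\<lambda>x. x - 1) (take d xs)) + mset (drop d xs) + {# d + s, s - 1 #}))"

definition konan_step :: "nat \<Rightarrow> nat \<times> ptn \<Rightarrow> nat \<times> ptn" where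
  "konan_step r = (\<lambda>(t, \<nu>).
    if r + 2 * t \<in> Top \<nu> then konan_K1 r (t, \<nu>) else konan_K2 r (t, \<nu>))"

text \<open>The loop runs as long as (K1) or (K2) is applicable.\<close>

definition konan :: "nat \<Rightarrow> ptn \<Rightarrow> ptn" where
  "konan r \<gamma> =
    (let t = (mex_above r \<gamma> - r - 1) div 2
     in snd (while (\<lambda>(t, \<nu>). r + 2 * t \<in> Top \<nu> \<or> 1 \<le> t) (konan_step r)
          (t, \<gamma> - Delta r (2 * t))))"

definition konan_inv :: "nat \<Rightarrow> ptn \<Rightarrow> ptn" where
  "konan_inv r = the_inv_into (mex_ptns r) (konan r)"

section \<open>The maps \<open>U\<^sub>r\<close> and \<open>B\<^sub>r\<close>\<close>

datatype atom = U

datatype marked_part = Marked nat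

definition U_map :: "nat \<Rightarrow> ptn \<Rightarrow> ptn" where
  "U_map r \<nu> = (THE \<mu>. \<mu> \<in> partitions \<and>
     frobenius \<mu> =
       (map (\<lambda>a. if a = r - 1 then r else a) (fst (frobenius \<nu>)), snd (frobenius \<nu>)))"

text \<open>\<open>B_map r\<close> is only meant for arguments in
  \<open>partitions \<times> {Marked r} \<times> frob_ptns r\<close>.\<close>

definition B_map :: "nat \<Rightarrow> ptn \<times> marked_part \<times> ptn \<Rightarrow> ptn \<times> ptn" where
  "B_map r = (\<lambda>(\<alpha>, _, \<nu>).
    if r - 1 \<notin> Top \<nu> then (\<alpha> + {# r #}, \<nu>) else (\<alpha> + {# r - 1 #}, U_map r \<nu>))"

section \<open>The pairs counted and their generating function\<close>

definition C_pairs :: "nat \<Rightarrow> (ptn \<times> ptn) set" where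
  "C_pairs r = {(\<alpha>, \<beta>). \<alpha> \<in> partitions \<and> \<beta> \<in> partitions \<and> (\<exists>d. mex \<beta> = r + 2 * d + 1)}"

text \<open>\<open>int \<Rightarrow>\<^sub>0 int\<close> with convolution is the ring of Laurent polynomials $\mathbb{Z}[z, z^{-1}]$,
  and \<open>zpow k\<close> is $z^k$.\<close>

type_synonym laurent_poly = "int \<Rightarrow>\<^sub>0 int"

definition zpow :: "int \<Rightarrow> laurent_poly" where
  "zpow k = Poly_Mapping.single k 1"

definition C_series :: "nat \<Rightarrow> laurent_poly fps" where
  "C_series r = Abs_fps (\<lambda>n.
    \<Sum>(\<alpha>, \<beta>) \<in> {(\<alpha>, \<beta>) \<in> C_pairs r. sum_mset \<alpha> + sum_mset \<beta> = n}.
      zpow (int (size \<alpha>) - int (size \<beta>)))"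

definition coeff_le :: "laurent_poly fps \<Rightarrow> laurent_poly fps \<Rightarrow> bool" (infix \<open>\<preceq>\<close> 50) where
  "G \<preceq> F \<longleftrightarrow> (\<forall>n k. 0 \<le> Poly_Mapping.lookup (fps_nth (F - G) n) k)"

text \<open>The sums in \<open>C_series\<close> are finite.\<close>

lemma size_le_sum_mset:
  assumes "\<nu> \<in> partitions" shows "size \<nu> \<le> sum_mset \<nu>"
proof -
  have "0 \<notin># \<nu> \<Longrightarrow> size \<nu> \<le> sum_mset \<nu>"
    by (induction \<nu>) auto
  then show ?thesis using assms by (simp add: partitions_def)
qed

lemma finite_partitions_le: "finite {\<nu> \<in> partitions. sum_mset \<nu> \<le> n}"
proof (rule finite_subset)
  show "{\<nu> \<in> partitions. sum_mset \<nu> \<le> n} \<subseteq> mset ` {xs. set xs \<subseteq> {0..n} \<and> length xs \<le> n}"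
  proof
    fix \<nu> assume A: "\<nu> \<in> {\<nu> \<in> partitions. sum_mset \<nu> \<le> n}"
    obtain xs where xs: "mset xs = \<nu>" using ex_mset by blast
    have "size \<nu> \<le> n" using size_le_sum_mset[of \<nu>] A by auto
    moreover have "x \<le> n" if "x \<in># \<nu>" for x
    proof -
      have "\<nu> = {# x #} + (\<nu> - {# x #})" using that by simp
      then have "sum_mset \<nu> = x + sum_mset (\<nu> - {# x #})"
        by (metis sum_mset.union sum_mset.singleton)
      then show ?thesis using A by simp
    qed
    ultimately have "xs \<in> {xs. set xs \<subseteq> {0..n} \<and> length xs \<le> n}"
      using xs by auto
    then show "\<nu> \<in> mset ` {xs. set xs \<subseteq> {0..n} \<and> length xs \<le> n}" using xs by blast
  qed
  show "finite (mset ` {xs. set xs \<subseteq> {0..n} \<and> length xs \<le> n})"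
    by (intro finite_imageI finite_lists_length_le) simp
qed

lemma finite_C_pairs_size:
  "finite {(\<alpha>, \<beta>) \<in> C_pairs r. sum_mset \<alpha> + sum_mset \<beta> = n}"
  by (rule finite_subset[of _ "{\<nu> \<in> partitions. sum_mset \<nu> \<le> n} \<times> {\<nu> \<in> partitions. sum_mset \<nu> \<le> n}"])
     (auto simp: C_pairs_def finite_partitions_le)

end

theory Submission
  imports Defs
begin

text \<open>A partition \<open>\<beta>\<close> has mex \<open>r + 2d + 1\<close> for some \<open>d\<close> exactly if it is the staircase \<open>\<delta>\<^sub>r\<close> together with some
  \<open>\<gamma> \<in> M\<^sub>r\<close>. Konan's bijection trades \<open>\<gamma>\<close> for a partition \<open>\<lambda> \<in> F\<^sub>r\<close> of the same size and length, so
  \<open>C\<^sub>r\<close> is a copy of \<open>P \<times> F\<^sub>r\<close> (\<open>C_pairs_iff\<close>, \<open>konan_bij_betw\<close>, \<open>konan_weight_eq\<close>). Passing from \<open>r\<close> to \<open>r - 1\<close>,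
  the staircase loses its part \<open>r\<close>, which is handed to \<open>\<alpha>\<close>; this raises the exponent of \<open>z\<close> by two.
  If \<open>\<lambda>\<close> is already in \<open>F\<^bsub>r-1\<^esub>\<close> nothing else is needed. Otherwise \<open>r - 1\<close> is in the top row and \<open>r\<close> is not,
  so that entry can be raised to \<open>r\<close>; this adds one cell to \<open>\<lambda>\<close>, and \<open>\<alpha>\<close> receives only \<open>r - 1\<close>. The two cases
  are told apart by whether \<open>r\<close> is in the new top row, hence nothing is lost (\<open>B_map_inj\<close>), and comparing
  coefficients is comparing cardinalities.

  What remains is Konan's bijection. Call a state initial if the loop can start there and terminal if it stops
  there. A single step turns out to be a bijection from the nonterminal states onto the noninitial ones
  (\<open>konan_step_bij\<close>), and it preserves the total size and length, of which only finitely many states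
  have given values. Such a map cuts every finite weight class into cycles and into paths from an initial to a
  terminal state, so the loop terminates on initial states and is a bijection from initial to terminal states
  (\<open>while_bij_betw\<close>). To see that a step is reversible, a
  partition is cut into the parts above and below the shifted staircase at level \<open>s = r + 2t\<close>: both kinds of steps
  become simple edits of the two pieces. A state with a part \<open>s + 1\<close> has a predecessor; the step
  from it is (K2) if \<open>s + 1\<close> is in the top row, and (K1) if not.\<close>

section \<open>Partitions as decreasing lists\<close>

lemma mset_parts_list [simp]: "mset (parts_list \<nu>) = \<nu>"
  by (simp add: parts_list_def)

lemma length_parts_list [simp]: "length (parts_list \<nu>) = size \<nu>"
  by (metis mset_parts_list size_mset)

lemma set_parts_list [simp]: "set (parts_list \<nu>) = set_mset \<nu>"
  by (metis mset_parts_list set_mset_mset)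

lemma sorted_parts_list: "sorted_wrt (\<ge>) (parts_list \<nu>)"
  by (simp add: parts_list_def sorted_wrt_rev)

lemma parts_list_eqI:
  assumes "sorted_wrt (\<ge>) xs" and "mset xs = \<nu>"
  shows "parts_list \<nu> = xs"
proof -
  have "sort xs = rev xs"
    using assms(1) by (intro properties_for_sort) (simp_all add: sorted_wrt_rev)
  then show ?thesis
    using assms(2) by (auto simp: parts_list_def)
qed

lemma parts_list_append:
  assumes "\<And>a b. a \<in># A \<Longrightarrow> b \<in># B \<Longrightarrow> b \<le> a"
  shows "parts_list (A + B) = parts_list A @ parts_list B"
  using assms by (intro parts_list_eqI) (auto simp: sorted_wrt_append sorted_parts_list)

lemma ith_part_in:
  assumes "1 \<le> i" and "i \<le> size \<nu>"
  shows "ith_part \<nu> i \<in># \<nu>"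
proof -
  have "parts_list \<nu> ! (i - 1) \<in> set (parts_list \<nu>)"
    using assms by (intro nth_mem) simp
  then show ?thesis using assms by (simp add: ith_part_def)
qed

lemma ith_part_antimono:
  assumes "1 \<le> i" and "i \<le> j"
  shows "ith_part \<nu> j \<le> ith_part \<nu> i"
proof (cases "j \<le> size \<nu> \<and> i < j")
  case True
  then have "parts_list \<nu> ! (i - 1) \<ge> parts_list \<nu> ! (j - 1)"
    using assms by (intro sorted_wrt_nth_less[OF sorted_parts_list]) auto
  then show ?thesis using assms True by (simp add: ith_part_def)
next
  case False
  then show ?thesis using assms by (cases "i = j") (auto simp: ith_part_def)
qed

lemma ex_ith_part:
  assumes "x \<in># \<nu>"
  obtains i where "1 \<le> i" and "i \<le> size \<nu>" and "ith_part \<nu> i = x"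
proof -
  obtain k where "k < size \<nu>" "parts_list \<nu> ! k = x"
    using assms by (metis in_set_conv_nth length_parts_list set_parts_list)
  then show ?thesis by (intro that[of "Suc k"]) (auto simp: ith_part_def)
qed

lemma ith_part_append:
  assumes "\<And>a b. a \<in># A \<Longrightarrow> b \<in># B \<Longrightarrow> b \<le> a" and "1 \<le> i"
  shows "ith_part (A + B) i = (if i \<le> size A then ith_part A i else ith_part B (i - size A))"
  using assms(2)
  by (auto simp: ith_part_def parts_list_append[OF assms(1)] nth_append)


section \<open>Cutting a partition along a shifted staircase\<close>

text \<open>In \<open>\<nu> = A + B\<close> the piece \<open>A\<close> consists of the first $d_s(\nu)$ parts. The condition
  compares parts only with the number \<open>size A\<close>, so a cut can be edited without indices or sorting. Both
  inequalities are weak because $\nu_{d+1} - (d+1) < s$ says $\nu_{d+1} \le s + d$.\<close>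

definition staircase_cut :: "nat \<Rightarrow> ptn \<Rightarrow> ptn \<Rightarrow> bool" where
  "staircase_cut s A B \<longleftrightarrow> (\<forall>a \<in># A. s + size A \<le> a) \<and> (\<forall>b \<in># B. b \<le> s + size A)"

lemma staircase_cutD:
  assumes "staircase_cut s A B"
  shows "a \<in># A \<Longrightarrow> s + size A \<le> a" and "b \<in># B \<Longrightarrow> b \<le> s + size A"
    and "a \<in># A \<Longrightarrow> b \<in># B \<Longrightarrow> b \<le> a"
  using assms by (fastforce simp: staircase_cut_def)+

lemma le_konan_d_iff:
  assumes "1 \<le> i"
  shows "i \<le> konan_d s \<nu> \<longleftrightarrow> s + i \<le> ith_part \<nu> i"
proof -
  let ?M = "{i \<in> {0..size \<nu>}. i = 0 \<or> s + i \<le> ith_part \<nu> i}"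
  have M: "finite ?M" "?M \<noteq> {}" by (auto intro: finite_subset[of _ "{0..size \<nu>}"])
  show ?thesis
  proof
    assume i: "i \<le> konan_d s \<nu>"
    have "konan_d s \<nu> \<in> ?M" unfolding konan_d_def using M by (rule Max_in)
    then have "s + konan_d s \<nu> \<le> ith_part \<nu> (konan_d s \<nu>)" using i assms by auto
    also have "\<dots> \<le> ith_part \<nu> i" using assms i by (rule ith_part_antimono)
    finally show "s + i \<le> ith_part \<nu> i" using i by simp
  next
    assume "s + i \<le> ith_part \<nu> i"
    moreover from this have "i \<le> size \<nu>" using assms by (auto simp: ith_part_def split: if_splits)
    ultimately show "i \<le> konan_d s \<nu>" unfolding konan_d_def using M by (intro Max_ge) auto
  qed
qed

lemma konan_d_staircase_cut:
  assumes "staircase_cut s A B"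
  shows "konan_d s (A + B) = size A"
proof (rule antisym)
  show "konan_d s (A + B) \<le> size A"
  proof (rule ccontr)
    assume "\<not> ?thesis"
    then have "s + Suc (size A) \<le> ith_part (A + B) (Suc (size A))"
      using le_konan_d_iff[of "Suc (size A)" s "A + B"] by simp
    then have "s + Suc (size A) \<le> ith_part B 1"
      by (simp add: ith_part_append staircase_cutD[OF assms])
    moreover from this have "ith_part B 1 \<in># B"
      by (intro ith_part_in) (auto simp: ith_part_def split: if_splits)
    ultimately show False using staircase_cutD(2)[OF assms] by fastforce
  qed
  show "size A \<le> konan_d s (A + B)"
  proof (cases "A = {#}")
    case False
    then have "1 \<le> size A" by (simp add: Suc_leI nonempty_has_size)
    moreover from this have "ith_part A (size A) \<in># A" by (intro ith_part_in) auto
    ultimately show ?thesis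
      using staircase_cutD(1)[OF assms] by (simp add: le_konan_d_iff ith_part_append staircase_cutD[OF assms])
  qed simp
qed

lemma ex_staircase_cut: "\<exists>A B. \<nu> = A + B \<and> staircase_cut s A B"
proof -
  let ?d = "konan_d s \<nu>" and ?xs = "parts_list \<nu>"
  let ?A = "mset (take ?d ?xs)" and ?B = "mset (drop ?d ?xs)"
  have "?d \<le> size \<nu>"
    using le_konan_d_iff[of ?d s \<nu>] by (cases "?d = 0") (auto simp: ith_part_def split: if_splits)
  then have sz: "size ?A = ?d" by simp
  have "s + ?d \<le> a" if "a \<in># ?A" for a
  proof -
    from that obtain k where k: "k < ?d" "a = ?xs ! k"
      by (auto simp: in_set_conv_nth)
    have "s + ?d \<le> ith_part \<nu> ?d" using k le_konan_d_iff[of ?d s \<nu>] by simp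
    also have "\<dots> \<le> ith_part \<nu> (Suc k)" using k by (intro ith_part_antimono) auto
    finally show ?thesis using k \<open>?d \<le> size \<nu>\<close> by (simp add: ith_part_def)
  qed
  moreover have "b \<le> s + ?d" if "b \<in># ?B" for b
  proof -
    from that obtain k where k: "?d + k < size \<nu>" "b = ?xs ! (?d + k)"
      by (auto simp: in_set_conv_nth less_diff_conv add.commute)
    then have "b = ith_part \<nu> (Suc (?d + k))" by (simp add: ith_part_def)
    also have "\<dots> \<le> ith_part \<nu> (Suc ?d)" by (intro ith_part_antimono) auto
    also have "\<dots> \<le> s + ?d" using le_konan_d_iff[of "Suc ?d" s \<nu>] by simp
    finally show ?thesis .
  qed
  moreover have "\<nu> = ?A + ?B"
    by (metis append_take_drop_id mset_append mset_parts_list)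
  ultimately show ?thesis unfolding staircase_cut_def using sz by metis
qed

lemma take_drop_parts_list:
  assumes "\<And>a b. a \<in># A \<Longrightarrow> b \<in># B \<Longrightarrow> b \<le> a"
  shows "mset (take (size A) (parts_list (A + B))) = A"
    and "mset (drop (size A) (parts_list (A + B))) = B"
  using parts_list_append[OF assms, of A B] by simp_all

text \<open>The size of the upper piece is forced to be $d_s$, and it contains the largest parts.\<close>

lemma staircase_cut_unique:
  assumes "staircase_cut s A B" "staircase_cut s A' B'" "A + B = A' + B'"
  shows "A = A' \<and> B = B'"
  by (metis assms konan_d_staircase_cut take_drop_parts_list staircase_cutD(3))

lemma durfee_eq: "durfee \<nu> = konan_d 0 \<nu>"
  by (simp add: durfee_def konan_d_def)

lemma le_durfee_iff: "1 \<le> i \<Longrightarrow> i \<le> durfee \<nu> \<longleftrightarrow> i \<le> ith_part \<nu> i"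
  by (simp add: durfee_eq le_konan_d_iff)

lemma Top_iff: "s \<in> Top \<nu> \<longleftrightarrow> (\<exists>i\<ge>1. ith_part \<nu> i = s + i)"
proof -
  have "s \<in> Top \<nu> \<longleftrightarrow> (\<exists>i. 1 \<le> i \<and> i \<le> durfee \<nu> \<and> ith_part \<nu> i - i = s)"
    by (auto simp: Top_def frobenius_def less_Suc_eq_le intro!: image_eqI)
  then show ?thesis by (metis le_durfee_iff add_diff_cancel_right' le_add2 le_add_diff_inverse2)
qed

text \<open>The differences $\nu_i - i$ strictly decrease, so \<open>s\<close> can only be attained at the last index
  \<open>i = size A\<close> of the upper piece, whose parts are all at least \<open>s + size A\<close>.\<close>

lemma Top_staircase_cut:
  assumes "staircase_cut s A B"
  shows "s \<in> Top (A + B) \<longleftrightarrow> s + size A \<in># A"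
proof
  assume "s \<in> Top (A + B)"
  then obtain i where i: "i \<ge> 1" "ith_part (A + B) i = s + i" by (auto simp: Top_iff)
  then have le: "i \<le> size A" using le_konan_d_iff[of i s "A + B"] konan_d_staircase_cut[OF assms] by simp
  then have "s + i \<in># A"
    using i ith_part_in[of i A] by (simp add: ith_part_append staircase_cutD[OF assms])
  moreover from this have "s + size A \<le> s + i" using staircase_cutD(1)[OF assms] by blast
  ultimately show "s + size A \<in># A" using le by simp
next
  assume A: "s + size A \<in># A"
  then obtain i where i: "1 \<le> i" "i \<le> size A" "ith_part A i = s + size A"
    by (rule ex_ith_part)
  then have "ith_part A (size A) \<le> s + size A" using ith_part_antimono[of i "size A" A] by simp
  moreover have "ith_part A (size A) \<in># A" using i by (intro ith_part_in) auto
  ultimately have "ith_part A (size A) = s + size A" using staircase_cutD(1)[OF assms] by (meson antisym)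
  then show "s \<in> Top (A + B)"
    using i unfolding Top_iff by (intro exI[of _ "size A"]) (simp add: ith_part_append staircase_cutD[OF assms])
qed


section \<open>One step of Konan's iteration\<close>

text \<open>The steps (K1) and (K2), parametrised by the pieces that survive them. Deleting the part \<open>d + s\<close> in
  (K1) leaves the \<open>d - 1\<close> parts above it strictly above the staircase, hence \<open>A\<close> and \<open>B\<close> form a cut at
  level \<open>s + 1\<close>. In (K2) the parts above the staircase are already strictly above it, so they have the
  form \<open>Suc a\<close>, and subtracting \<open>1\<close> gives \<open>A\<close>; there \<open>t\<close> denotes the new value, so that the old level is
  \<open>r + 2t + 2\<close>. The condition \<open>A \<noteq> {#}\<close> excludes \<open>d = 1\<close>, where (K1) deletes and reinserts the same part.\<close>

inductive konan_rel :: "nat \<Rightarrow> nat \<times> ptn \<Rightarrow> nat \<times> ptn \<Rightarrow> bool" for r where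
  K1: "staircase_cut (r + 2 * t + 1) A B \<Longrightarrow> A \<noteq> {#} \<Longrightarrow>
    konan_rel r (t, A + {#r + 2 * t + 1 + size A#} + B)
      (t, image_mset Suc A + (B + {#r + 2 * t + 1#}))"
| K2: "staircase_cut (r + 2 * t + 2) A B \<Longrightarrow>
    konan_rel r (Suc t, image_mset Suc A + B)
      (t, (A + {#r + 2 * t + 2 + size A#}) + (B + {#r + 2 * t + 1#}))"

text \<open>If the largest part is \<open>s + 1\<close> then \<open>s\<close> is in the top row with \<open>d = 1\<close>, and (K1) changes nothing forever.
  Such states are excluded; they are never reached from a partition without a part \<open>s + 1\<close>.\<close>

definition konan_states :: "nat \<Rightarrow> (nat \<times> ptn) set" where
  "konan_states r = {(t, \<nu>). \<nu> \<in> partitions \<and>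
     \<not> (r + 2 * t + 1 \<in># \<nu> \<and> (\<forall>x \<in># \<nu>. x \<le> r + 2 * t + 1))}"

text \<open>The part \<open>r + 2t + 1\<close> is missing exactly if $\Delta_{r,2t} \sqcup \nu$ has
  $\mathrm{mex}_r$ equal to \<open>r + 2t + 1\<close>.\<close>

definition konan_initial :: "nat \<Rightarrow> (nat \<times> ptn) set" where
  "konan_initial r = {(t, \<nu>). \<nu> \<in> partitions \<and> r + 2 * t + 1 \<notin># \<nu>}"

abbreviation konan_active :: "nat \<Rightarrow> nat \<times> ptn \<Rightarrow> bool" where
  "konan_active r \<equiv> \<lambda>(t, \<nu>). r + 2 * t \<in> Top \<nu> \<or> 1 \<le> t"

text \<open>Size and length of $\Delta_{r,2t} \sqcup \nu$.\<close>

definition konan_weight :: "nat \<Rightarrow> nat \<times> ptn \<Rightarrow> nat \<times> nat" where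
  "konan_weight r = (\<lambda>(t, \<nu>). (sum_mset (Delta r (2 * t)) + sum_mset \<nu>, 2 * t + size \<nu>))"

text \<open>The last step can be recognised from the cut at level \<open>s + 1\<close>, for the new value of \<open>s\<close>: if the upper
  piece of this cut has size \<open>e\<close>, it contains the diagonal part \<open>s + 1 + e\<close> after (K2) and not after (K1). This
  and the next three lemmas place the surviving pieces in the cuts before and after a step.\<close>

lemma staircase_cut_K1_before:
  assumes "staircase_cut (s + 1) A B"
  shows "staircase_cut s (A + {#s + 1 + size A#}) B"
  using assms by (auto simp: staircase_cut_def)

lemma staircase_cut_K1_after:
  assumes "staircase_cut (s + 1) A B"
  shows "staircase_cut (s + 1) (image_mset Suc A) (B + {#s + 1#})"
  using assms by (auto simp: staircase_cut_def)

lemma staircase_cut_K2_before: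
  assumes "staircase_cut s A B"
  shows "staircase_cut s (image_mset Suc A) B"
  using assms by (auto simp: staircase_cut_def)

lemma staircase_cut_K2_after:
  assumes "staircase_cut (s + 2) A B"
  shows "staircase_cut (s + 1) (A + {#s + 2 + size A#}) (B + {#s + 1#})"
  using assms by (auto simp: staircase_cut_def)

lemma konan_rel_step:
  assumes "konan_rel r x y"
  shows "konan_step r x = y" and "konan_active r x"
proof -
  have "konan_step r x = y \<and> konan_active r x"
    using assms
  proof cases
    case (K1 t A B)
    let ?s = "r + 2 * t"
    let ?C = "A + {#?s + 1 + size A#}"
    note c = staircase_cut_K1_before[OF K1(3)]
    have top: "?s \<in> Top (?C + B)" using Top_staircase_cut[OF c] by simp
    have d: "konan_d ?s (?C + B) = Suc (size A)" using konan_d_staircase_cut[OF c] by simp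
    have 1: "mset (drop (Suc (size A)) (parts_list (?C + B))) = B"
      using take_drop_parts_list(2)[of ?C B] staircase_cutD(3)[OF c] by simp
    have "mset (take (size A) (parts_list (A + ({#?s + 1 + size A#} + B)))) = A"
      using staircase_cutD[OF K1(3)] by (intro take_drop_parts_list(1)) auto
    then have 2: "mset (take (size A) (parts_list (?C + B))) = A" by (simp add: ac_simps)
    have "konan_step r x = (t, image_mset (\<lambda>x. x + 1) A + B + {#?s + 1#})"
      using top 1 2 d unfolding K1(1) konan_step_def konan_K1_def Let_def
      by (simp only: case_prod_conv if_True diff_Suc_1 mset_map)
    then show ?thesis using K1 top by simp
  next
    case (K2 t A B)
    let ?s = "r + 2 * Suc t"
    let ?C = "image_mset Suc A"
    have c: "staircase_cut ?s ?C B" using staircase_cut_K2_before K2(3) by simp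
    have "?s \<notin> Top (?C + B)" using Top_staircase_cut[OF c] staircase_cutD(1)[OF K2(3)] by fastforce
    moreover have "konan_d ?s (?C + B) = size A" using konan_d_staircase_cut[OF c] by simp
    moreover have "mset (take (size A) (parts_list (?C + B))) = ?C"
      "mset (drop (size A) (parts_list (?C + B))) = B"
      using take_drop_parts_list[of ?C B] staircase_cutD(3)[OF c] by simp_all
    ultimately have "konan_step r x =
        (t, image_mset (\<lambda>x. x - 1) ?C + B + {#size A + ?s, ?s - 1#})"
      unfolding K2 by (simp add: konan_step_def konan_K2_def Let_def)
    then show ?thesis using K2 by (simp add: multiset.map_comp comp_def ac_simps)
  qed
  then show "konan_step r x = y" "konan_active r x" by auto
qed

lemma ex_image_Suc:
  fixes A :: ptn
  assumes "0 \<notin># A"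
  obtains A' where "A = image_mset Suc A'"
proof -
  have "image_mset Suc (image_mset (\<lambda>x. x - 1) A) = image_mset (\<lambda>x. x) A"
    unfolding multiset.map_comp
    by (rule image_mset_cong) (use assms in \<open>metis comp_apply Suc_diff_1 gr0I\<close>)
  then show ?thesis using that by (metis multiset.map_ident)
qed

lemma konan_rel_total:
  assumes "x \<in> konan_states r" and "konan_active r x"
  shows "\<exists>y. konan_rel r x y"
proof -
  obtain t \<nu> where x: "x = (t, \<nu>)" by force
  let ?s = "r + 2 * t"
  obtain A B where \<nu>: "\<nu> = A + B" and c: "staircase_cut ?s A B" using ex_staircase_cut by blast
  show ?thesis
  proof (cases "?s \<in> Top \<nu>")
    case True
    then have "?s + size A \<in># A" using Top_staircase_cut[OF c] \<nu> by simp
    then obtain A' where A: "A = A' + {#?s + size A#}" by (metis add_mset_add_single mset_add)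
    then have sz: "size A = Suc (size A')" by (metis add_mset_add_single size_add_mset)
    have c': "staircase_cut (?s + 1) A' B"
      using c sz by (subst (asm) A) (auto simp: staircase_cut_def)
    have "A' \<noteq> {#}"
    proof
      assume "A' = {#}"
      then have "\<nu> = {#?s + 1#} + B" "\<forall>b\<in>#B. b \<le> ?s + 1" using A sz \<nu> c by (auto simp: staircase_cut_def)
      then show False using assms(1) by (auto simp: x konan_states_def)
    qed
    from K1[OF c' this] show ?thesis using A sz \<nu> x by (metis add_Suc_shift Suc_eq_plus1 add.assoc)
  next
    case False
    then obtain t' where t: "t = Suc t'" using assms(2) x by (cases t) auto
    have A: "?s + size A < a" if "a \<in># A" for a
      using that staircase_cutD(1)[OF c that] Top_staircase_cut[OF c] False \<nu> by (metis le_neq_implies_less)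
    then have "0 \<notin># A" by blast
    then obtain A' where A': "A = image_mset Suc A'" by (rule ex_image_Suc)
    have "?s + size A' \<le> a" if "a \<in># A'" for a
      using A[of "Suc a"] that by (simp add: A')
    then have "staircase_cut (r + 2 * t' + 2) A' B"
      using c t by (auto simp: A' staircase_cut_def)
    from K2[OF this] show ?thesis using x t A' \<nu> by blast
  qed
qed

lemma konan_rel_range:
  assumes "konan_rel r x y" and "x \<in> konan_states r"
  shows "y \<in> konan_states r - konan_initial r"
  using assms(1)
proof cases
  case (K1 t A B)
  obtain a where "a \<in># A" using K1 by blast
  moreover from this have "r + 2 * t + 1 < Suc a" using staircase_cutD(1)[OF K1(3)] by fastforce
  ultimately have "\<exists>x \<in># image_mset Suc A. \<not> x \<le> r + 2 * t + 1" by force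
  then show ?thesis using K1 assms(2)
    by (auto simp: konan_states_def konan_initial_def partitions_def)
next
  case (K2 t A B)
  have "0 \<notin># A" using staircase_cutD(1)[OF K2(3)] by fastforce
  then show ?thesis using K2 assms(2)
    by (auto simp: konan_states_def konan_initial_def partitions_def)
qed

text \<open>Undoing a step: cut at level \<open>s + 1\<close>. The upper piece is nonempty because the largest part exceeds \<open>s + 1\<close>, hence
  the part \<open>s + 1\<close> is in the lower piece and can be removed. If the upper piece contains the diagonal part,
  removing it undoes (K2); otherwise all its parts can be lowered by one, which undoes (K1).\<close>

lemma konan_rel_onto:
  assumes "y \<in> konan_states r - konan_initial r"
  shows "\<exists>x \<in> konan_states r. konan_rel r x y"
proof -
  obtain t \<nu> where y: "y = (t, \<nu>)" by force
  let ?s = "r + 2 * t"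
  have \<nu>p: "0 \<notin># \<nu>" and in\<nu>: "?s + 1 \<in># \<nu>" and big: "\<not> (\<forall>x \<in># \<nu>. x \<le> ?s + 1)"
    using assms y by (auto simp: konan_states_def konan_initial_def partitions_def)
  obtain A C where \<nu>: "\<nu> = A + C" and c: "staircase_cut (?s + 1) A C" using ex_staircase_cut by blast
  have "A \<noteq> {#}" using big c \<nu> by (auto simp: staircase_cut_def)
  then have "?s + 1 \<notin># A" using staircase_cutD(1)[OF c, of "?s + 1"] by (auto simp: nonempty_has_size)
  then have "?s + 1 \<in># C" using in\<nu> \<nu> by simp
  then obtain B where C: "C = B + {#?s + 1#}" by (metis add_mset_add_single mset_add)
  show ?thesis
  proof (cases "?s + 1 + size A \<in># A")
    case True
    then obtain A' where A: "A = A' + {#?s + 1 + size A#}" by (metis add_mset_add_single mset_add)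
    then have sz: "size A = Suc (size A')" by (metis add_mset_add_single size_add_mset)
    have c': "staircase_cut (?s + 2) A' B"
      using c sz unfolding C by (subst (asm) A) (auto simp: staircase_cut_def)
    have "\<not> (?s + 3 \<in># image_mset Suc A' + B \<and> (\<forall>x \<in># image_mset Suc A' + B. x \<le> ?s + 3))"
    proof (cases "A' = {#}")
      case True
      then show ?thesis using staircase_cutD(2)[OF c', of "?s + 3"] by auto
    next
      case False
      then obtain a where a: "a \<in># A'" by blast
      then have "?s + 3 < Suc a"
        using staircase_cutD(1)[OF c', of a] False by (auto simp: nonempty_has_size)
      moreover have "Suc a \<in># image_mset Suc A' + B" using a by simp
      ultimately show ?thesis by (meson not_le)
    qed
    then have "(Suc t, image_mset Suc A' + B) \<in> konan_states r"
      using \<nu>p \<nu> C by (auto simp: konan_states_def partitions_def numeral_eq_Suc)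
    moreover have "y = (t, (A' + {#?s + 2 + size A'#}) + (B + {#?s + 1#}))"
      using A sz \<nu> C y by simp
    ultimately show ?thesis using K2[OF c'] by blast
  next
    case False
    have A: "?s + 1 + size A < a" if "a \<in># A" for a
      using that staircase_cutD(1)[OF c that] False by (metis le_neq_implies_less)
    then have "0 \<notin># A" by blast
    then obtain A' where A': "A = image_mset Suc A'" by (rule ex_image_Suc)
    have "?s + 1 + size A' \<le> a" if "a \<in># A'" for a
      using A[of "Suc a"] that by (simp add: A')
    then have c': "staircase_cut (?s + 1) A' B"
      using c unfolding C by (auto simp: A' staircase_cut_def)
    have ne: "A' \<noteq> {#}" using \<open>A \<noteq> {#}\<close> A' by simp
    then have "0 < size A'" by (simp add: nonempty_has_size)
    moreover have "0 \<notin># A'" using staircase_cutD(1)[OF c'] by fastforce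
    ultimately have "(t, A' + {#?s + 1 + size A'#} + B) \<in> konan_states r"
      using \<nu>p \<nu> C by (auto simp: konan_states_def partitions_def)
    moreover have "y = (t, image_mset Suc A' + (B + {#?s + 1#}))"
      using A' \<nu> C y by simp
    ultimately show ?thesis using K1[OF c' ne] by blast
  qed
qed

text \<open>The cut at level \<open>s + 1\<close> of the new state is unique, and by the presence of its diagonal part it tells (K1)
  from (K2) and then determines the surviving pieces.\<close>

lemma konan_rel_inj:
  assumes "konan_rel r x y" and "konan_rel r x' y"
  shows "x = x'"
proof -
  have case1: False
    if "staircase_cut (s + 1) A B" "staircase_cut (s + 2) A' B'"
      "image_mset Suc A + (B + {#s + 1#}) = (A' + {#s + 2 + size A'#}) + (B' + {#s + 1#})"
    for s A B A' B'
  proof -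
    \<comment> \<open>After (K1) all parts of the upper piece exceed the diagonal part that (K2) inserts.\<close>
    have *: "image_mset Suc A = A' + {#s + 2 + size A'#}"
      using staircase_cut_unique[OF staircase_cut_K1_after[OF that(1)] staircase_cut_K2_after[OF that(2)] that(3)] by simp
    then have sz: "size A = Suc (size A')" by (metis add_mset_add_single size_add_mset size_image_mset)
    have "s + 2 + size A' \<in># image_mset Suc A" using * by simp
    then obtain a where "a \<in># A" "s + 2 + size A' = Suc a" by auto
    then show False using staircase_cutD(1)[OF that(1), of a] sz by simp
  qed
  from assms(1) show ?thesis
  proof cases
    case (K1 t A B)
    note 1 = K1
    from assms(2) show ?thesis
    proof cases
      case (K1 t' A' B')
      then have "t' = t" and
        eq: "image_mset Suc A + (B + {#r + 2 * t + 1#}) = image_mset Suc A' + (B' + {#r + 2 * t + 1#})"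
        using 1 by auto
      then have "image_mset Suc A = image_mset Suc A' \<and> B + {#r + 2 * t + 1#} = B' + {#r + 2 * t + 1#}"
        using 1 K1 by (intro staircase_cut_unique[OF staircase_cut_K1_after staircase_cut_K1_after eq]) auto
      then have "A = A'" "B = B'" by (auto dest: injD[OF multiset.inj_map[OF inj_Suc]])
      then show ?thesis using 1 K1 \<open>t' = t\<close> by simp
    next
      case (K2 t' A' B')
      then show ?thesis using case1[of "r + 2 * t" A B A' B'] 1 by auto
    qed
  next
    case (K2 t A B)
    note 2 = K2
    from assms(2) show ?thesis
    proof cases
      case (K1 t' A' B')
      then show ?thesis using case1[of "r + 2 * t" A' B' A B] 2 by auto
    next
      case (K2 t' A' B')
      then have "t' = t" and
        eq: "(A + {#r + 2 * t + 2 + size A#}) + (B + {#r + 2 * t + 1#}) =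
          (A' + {#r + 2 * t + 2 + size A'#}) + (B' + {#r + 2 * t + 1#})"
        using 2 by auto
      then have *: "A + {#r + 2 * t + 2 + size A#} = A' + {#r + 2 * t + 2 + size A'#} \<and>
          B + {#r + 2 * t + 1#} = B' + {#r + 2 * t + 1#}"
        using 2 K2 by (intro staircase_cut_unique[OF staircase_cut_K2_after staircase_cut_K2_after eq]) auto
      then have "size A = size A'" by (metis add_mset_add_single size_add_mset nat.inject)
      then show ?thesis using * 2 K2 \<open>t' = t\<close> by simp
    qed
  qed
qed

lemma sum_mset_image_Suc: "sum_mset (image_mset Suc A) = sum_mset A + size A"
  by (induction A) auto

lemma Delta_Suc: "Delta r (Suc t) = Delta r t + {#r + Suc t#}"
proof -
  have "{r + 1..r + Suc t} = insert (r + Suc t) {r + 1..r + t}" by auto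
  then show ?thesis by (simp add: Delta_def)
qed

lemma konan_rel_weight:
  assumes "konan_rel r x y"
  shows "konan_weight r y = konan_weight r x"
  using assms
  by cases (auto simp: konan_weight_def sum_mset_image_Suc Delta_Suc)

lemma finite_konan_weight: "finite {x \<in> konan_states r. konan_weight r x = w}"
proof (rule finite_subset)
  show "{x \<in> konan_states r. konan_weight r x = w} \<subseteq>
      {..snd w} \<times> {\<nu> \<in> partitions. sum_mset \<nu> \<le> fst w}"
    by (auto simp: konan_states_def konan_weight_def)
  show "finite ({..snd w} \<times> {\<nu> \<in> partitions. sum_mset \<nu> \<le> fst w})"
    by (simp add: finite_partitions_le)
qed

lemma konan_step_bij:
  "bij_betw (konan_step r) {x \<in> konan_states r. konan_active r x} (konan_states r - konan_initial r)"
proof -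
  have rel: "konan_rel r x (konan_step r x)" if "x \<in> konan_states r" "konan_active r x" for x
    using konan_rel_total[OF that] konan_rel_step(1) by blast
  show ?thesis
  proof (rule bij_betwI')
    show "(konan_step r x = konan_step r y) = (x = y)"
      if "x \<in> {x \<in> konan_states r. konan_active r x}" "y \<in> {x \<in> konan_states r. konan_active r x}"
      for x y
      using that rel[of x] rel[of y] konan_rel_inj by (metis (no_types, lifting) mem_Collect_eq)
    show "konan_step r x \<in> konan_states r - konan_initial r"
      if "x \<in> {x \<in> konan_states r. konan_active r x}" for x
      using that rel konan_rel_range by blast
    show "\<exists>x\<in>{x \<in> konan_states r. konan_active r x}. y = konan_step r x"
      if "y \<in> konan_states r - konan_initial r" for y
      using konan_rel_onto[OF that] konan_rel_step by blast
  qed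
qed


section \<open>Loops over a bijection with finite weight classes\<close>

lemma while_eq_funpow:
  assumes "\<And>j. j < k \<Longrightarrow> b ((c ^^ j) x)" and "\<not> b ((c ^^ k) x)"
  shows "while b c x = (c ^^ k) x"
  using assms
proof (induction k arbitrary: x)
  case 0
  then show ?case by (simp add: while_unfold)
next
  case (Suc k)
  have "while b c x = while b c (c x)"
    using Suc.prems(1)[of 0] by (subst while_unfold) simp
  also have "\<dots> = (c ^^ k) (c x)"
    using Suc.prems(1)[of "Suc _"] Suc.prems(2) by (intro Suc.IH) (simp_all add: funpow_swap1)
  finally show ?case by (simp add: funpow_swap1)
qed

text \<open>Outside \<open>I\<close> every element of \<open>X\<close> has exactly one predecessor, and elements of \<open>I\<close> have none. If
  runs from two elements of \<open>I\<close> meet, walk both back until one of them is at its start \<open>x\<close>. Then \<open>x\<close> lies on the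
  other run, and having no predecessor it is also the start of that run. So a run never repeats, which by
  finiteness makes it stop, and distinct starts have distinct ends. Surjectivity follows by counting in the finite set of elements of equal weight, in which the active
  elements are as many as those outside \<open>I\<close>.\<close>

lemma while_bij_betw:
  assumes bij: "bij_betw c {x \<in> X. b x} (X - I)" and I: "I \<subseteq> X"
    and w: "\<And>x. x \<in> X \<Longrightarrow> b x \<Longrightarrow> w (c x) = w x"
    and fin: "\<And>n. finite {x \<in> X. w x = n}"
  shows "bij_betw (while b c) I {x \<in> X. \<not> b x}"
    and "\<And>x. x \<in> I \<Longrightarrow> w (while b c x) = w x"
proof -
  have c_in: "c x \<in> X - I" if "x \<in> X" "b x" for x
    using bij that by (auto simp: bij_betw_def)
  have c_inj: "x = y" if "x \<in> X" "b x" "y \<in> X" "b y" "c x = c y" for x y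
    using bij that by (auto simp: bij_betw_def inj_on_def)
  define run where "run k x \<longleftrightarrow> (\<forall>j<k. b ((c ^^ j) x))" for k x
  have run_in: "(c ^^ k) x \<in> X \<and> w ((c ^^ k) x) = w x" if "x \<in> X" "run k x" for k x
    using that(2)
  proof (induction k)
    case 0
    then show ?case using that by simp
  next
    case (Suc k)
    then have "b ((c ^^ k) x)" "run k x" by (auto simp: run_def)
    then show ?case using Suc.IH c_in w by simp
  qed
  have run_notin: "(c ^^ k) x \<notin> I" if "x \<in> X" "run k x" "0 < k" for k x
  proof -
    from that(3) obtain j where "k = Suc j" using gr0_implies_Suc by blast
    moreover from this have "run j x" "b ((c ^^ j) x)" using that(2) by (auto simp: run_def)
    ultimately show ?thesis using c_in run_in that(1) by simp
  qed
  have cancel: "i = j \<and> x = y"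
    if "x \<in> I" "y \<in> X" "run i x" "run j y" "i \<le> j" "(c ^^ i) x = (c ^^ j) y" for x y i j
    using that(3-)
  proof (induction i arbitrary: j)
    case 0
    then show ?case using run_notin[of y j] that(1,2) by (cases "j = 0") auto
  next
    case (Suc i)
    then obtain k where k: "j = Suc k" by (cases j) auto
    have r: "run i x" "run k y" "b ((c ^^ i) x)" "b ((c ^^ k) y)"
      using Suc.prems by (auto simp: k run_def)
    have "x \<in> X" using that(1) I by blast
    then have "(c ^^ i) x \<in> X" "(c ^^ k) y \<in> X"
      using run_in[of x i] run_in[of y k] r that(2) by blast+
    moreover have "c ((c ^^ i) x) = c ((c ^^ k) y)" using Suc.prems(4) by (simp add: k)
    ultimately have "(c ^^ i) x = (c ^^ k) y" using c_inj r(3,4) by blast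
    then show ?case using Suc.IH[of k] Suc.prems(3) r by (simp add: k)
  qed
  have stops: "\<exists>k. run k x \<and> while b c x = (c ^^ k) x \<and> \<not> b ((c ^^ k) x)" if "x \<in> I" for x
  proof -
    have "\<exists>k. \<not> b ((c ^^ k) x)"
    proof (rule ccontr)
      assume "\<nexists>k. \<not> b ((c ^^ k) x)"
      then have run: "run k x" for k by (simp add: run_def)
      have "inj (\<lambda>k. (c ^^ k) x)"
      proof (rule injI)
        fix i j assume "(c ^^ i) x = (c ^^ j) x"
        then show "i = j"
          using cancel[of x x i j] cancel[of x x j i] run[of i] run[of j] that I
          by (cases "i \<le> j") auto
      qed
      moreover have "range (\<lambda>k. (c ^^ k) x) \<subseteq> {y \<in> X. w y = w x}"
        using run_in[OF subsetD[OF I that] run] by blast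
      ultimately show False
        using finite_subset[OF _ fin[of "w x"]] finite_imageD infinite_UNIV_nat by blast
    qed
    then obtain k where "\<not> b ((c ^^ k) x)" "\<forall>j<k. \<not> \<not> b ((c ^^ j) x)"
      using exists_least_iff[of "\<lambda>k. \<not> b ((c ^^ k) x)"] by blast
    then show ?thesis using while_eq_funpow[of k b c x] by (auto simp: run_def)
  qed
  show weight: "w (while b c x) = w x" if "x \<in> I" for x
    using stops[OF that] run_in[OF subsetD[OF I that]] by auto
  have into: "while b c x \<in> {x \<in> X. \<not> b x}" if "x \<in> I" for x
    using stops[OF that] run_in[OF subsetD[OF I that]] by auto
  have inj: "inj_on (while b c) I"
  proof (rule inj_onI)
    fix x y assume xy: "x \<in> I" "y \<in> I" "while b c x = while b c y"
    obtain i j where "run i x" "run j y" "(c ^^ i) x = (c ^^ j) y"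
      using stops[OF xy(1)] stops[OF xy(2)] xy(3) by metis
    then show "x = y"
      using cancel[of x y i j] cancel[of y x j i] xy(1,2) I by (cases "i \<le> j") auto
  qed
  have "{x \<in> X. \<not> b x} \<subseteq> while b c ` I"
  proof
    fix z assume z: "z \<in> {x \<in> X. \<not> b x}"
    define Y where "Y = {x \<in> X. w x = w z}"
    have Y: "finite Y" using fin by (simp add: Y_def)
    have "bij_betw c {x \<in> Y. b x} (Y - I)"
      unfolding bij_betw_def
    proof
      show "inj_on c {x \<in> Y. b x}" using c_inj by (auto simp: inj_on_def Y_def)
      show "c ` {x \<in> Y. b x} = Y - I"
      proof
        show "c ` {x \<in> Y. b x} \<subseteq> Y - I" using c_in w by (auto simp: Y_def)
        show "Y - I \<subseteq> c ` {x \<in> Y. b x}"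
        proof
          fix y assume y: "y \<in> Y - I"
          then have "y \<in> c ` {x \<in> X. b x}" using bij by (auto simp: bij_betw_def Y_def)
          then show "y \<in> c ` {x \<in> Y. b x}" using y w by (auto simp: Y_def)
        qed
      qed
    qed
    then have "card {x \<in> Y. b x} = card (Y - I)" by (rule bij_betw_same_card)
    moreover have "card Y = card {x \<in> Y. b x} + card {x \<in> Y. \<not> b x}"
      using Y by (subst card_Un_disjoint[symmetric]) (auto intro: arg_cong[where f = card])
    moreover have "card Y = card (Y - I) + card (Y \<inter> I)"
      using Y by (metis card_Diff_subset_Int card_mono finite_Int inf_le1 le_add_diff_inverse2)
    ultimately have "card (Y \<inter> I) = card {x \<in> Y. \<not> b x}" by simp
    moreover have "card (while b c ` (Y \<inter> I)) = card (Y \<inter> I)"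
      using inj by (intro card_image) (auto simp: inj_on_def)
    moreover have "while b c ` (Y \<inter> I) \<subseteq> {x \<in> Y. \<not> b x}"
      using into weight by (auto simp: Y_def)
    ultimately have "while b c ` (Y \<inter> I) = {x \<in> Y. \<not> b x}"
      using Y by (intro card_subset_eq) auto
    then show "z \<in> while b c ` I" using z by (auto simp: Y_def)
  qed
  then show "bij_betw (while b c) I {x \<in> X. \<not> b x}"
    using inj into by (auto simp: bij_betw_def)
qed


section \<open>Konan's bijection\<close>

lemma mex_above_props:
  shows less_mex_above: "r < mex_above r \<nu>"
    and mex_above_notin: "mex_above r \<nu> \<notin># \<nu>"
    and below_mex_above: "r < t \<Longrightarrow> t < mex_above r \<nu> \<Longrightarrow> t \<in># \<nu>"
proof -
  have "\<not> {r<..} \<subseteq> set_mset \<nu>"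
    using finite_subset[of "{r<..}" "set_mset \<nu>"] infinite_Ioi[of r] by auto
  then have ex: "\<exists>t. r < t \<and> count \<nu> t = 0" by (auto simp: not_in_iff)
  show "r < mex_above r \<nu>" "mex_above r \<nu> \<notin># \<nu>"
    using LeastI_ex[OF ex] by (auto simp: mex_above_def not_in_iff)
  show "r < t \<Longrightarrow> t < mex_above r \<nu> \<Longrightarrow> t \<in># \<nu>"
    using not_less_Least[of t "\<lambda>t. r < t \<and> count \<nu> t = 0"] by (auto simp: mex_above_def not_in_iff)
qed

lemma mex_above_eqI:
  assumes "r < m" and "m \<notin># \<nu>" and "\<And>t. r < t \<Longrightarrow> t < m \<Longrightarrow> t \<in># \<nu>"
  shows "mex_above r \<nu> = m"
  using assms less_mex_above[of r \<nu>] mex_above_notin[of r \<nu>] below_mex_above[of r _ \<nu>]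
  by (metis linorder_neqE_nat)

lemma Delta_subseteq_iff: "Delta r t \<subseteq># \<nu> \<longleftrightarrow> (\<forall>x. r < x \<and> x \<le> r + t \<longrightarrow> x \<in># \<nu>)"
proof -
  have "Delta r t \<subseteq># \<nu> \<longleftrightarrow> (\<forall>x. r < x \<and> x \<le> r + t \<longrightarrow> 1 \<le> count \<nu> x)"
    unfolding Delta_def subseteq_mset_def by (auto simp: count_mset_set')
  then show ?thesis by (simp add: Suc_le_eq)
qed

lemma in_Delta_iff [simp]: "x \<in># Delta r t \<longleftrightarrow> r < x \<and> x \<le> r + t"
  by (auto simp: Delta_def)

lemma size_Delta [simp]: "size (Delta r t) = t"
  by (simp add: Delta_def)

definition konan_start :: "nat \<Rightarrow> ptn \<Rightarrow> nat \<times> ptn" where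
  "konan_start r \<gamma> = (let t = (mex_above r \<gamma> - r - 1) div 2 in (t, \<gamma> - Delta r (2 * t)))"

lemma konan_eq_while:
  "konan r \<gamma> = snd (while (konan_active r) (konan_step r) (konan_start r \<gamma>))"
  by (simp add: konan_def konan_start_def Let_def)

lemma mex_ptns_mex_above:
  assumes "\<gamma> \<in> mex_ptns r"
  obtains t where "mex_above r \<gamma> = r + 2 * t + 1"
proof -
  have "odd (mex_above r \<gamma> - r)" using assms by (simp add: mex_ptns_def)
  then obtain t where "mex_above r \<gamma> - r = 2 * t + 1" by (rule oddE)
  then show ?thesis using that[of t] less_mex_above[of r \<gamma>] by linarith
qed

lemma konan_start_Delta:
  assumes "mex_above r \<gamma> = r + 2 * t + 1"
  shows "konan_start r \<gamma> = (t, \<gamma> - Delta r (2 * t))" and "Delta r (2 * t) + (\<gamma> - Delta r (2 * t)) = \<gamma>"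
proof -
  show "konan_start r \<gamma> = (t, \<gamma> - Delta r (2 * t))" using assms by (simp add: konan_start_def)
  have "Delta r (2 * t) \<subseteq># \<gamma>"
    using below_mex_above[of r _ \<gamma>] assms by (auto simp: Delta_subseteq_iff)
  then show "Delta r (2 * t) + (\<gamma> - Delta r (2 * t)) = \<gamma>" by simp
qed

lemma konan_start_bij: "bij_betw (konan_start r) (mex_ptns r) (konan_initial r)"
proof (rule bij_betw_byWitness[where f' = "\<lambda>(t, \<nu>). Delta r (2 * t) + \<nu>"])
  show "\<forall>\<gamma>\<in>mex_ptns r. (case konan_start r \<gamma> of (t, \<nu>) \<Rightarrow> Delta r (2 * t) + \<nu>) = \<gamma>"
  proof
    fix \<gamma> assume "\<gamma> \<in> mex_ptns r"
    then obtain t where t: "mex_above r \<gamma> = r + 2 * t + 1" by (rule mex_ptns_mex_above)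
    show "(case konan_start r \<gamma> of (t, \<nu>) \<Rightarrow> Delta r (2 * t) + \<nu>) = \<gamma>"
      by (simp only: konan_start_Delta[OF t] case_prod_conv)
  qed
  show "konan_start r ` mex_ptns r \<subseteq> konan_initial r"
  proof
    fix x assume "x \<in> konan_start r ` mex_ptns r"
    then obtain \<gamma> where \<gamma>: "\<gamma> \<in> mex_ptns r" "x = konan_start r \<gamma>" by blast
    obtain t where t: "mex_above r \<gamma> = r + 2 * t + 1" using \<gamma>(1) by (rule mex_ptns_mex_above)
    then have "r + 2 * t + 1 \<notin># \<gamma>" using mex_above_notin by metis
    then show "x \<in> konan_initial r"
      using \<gamma> konan_start_Delta(1)[OF t]
      by (auto simp: konan_initial_def mex_ptns_def partitions_def dest: in_diffD)
  qed
  have mex: "mex_above r (Delta r (2 * t) + \<nu>) = r + 2 * t + 1" if "(t, \<nu>) \<in> konan_initial r" for t \<nu>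
    using that by (intro mex_above_eqI) (auto simp: konan_initial_def)
  then show "\<forall>x\<in>konan_initial r. konan_start r (case x of (t, \<nu>) \<Rightarrow> Delta r (2 * t) + \<nu>) = x"
    by (auto simp: konan_start_def)
  show "(\<lambda>(t, \<nu>). Delta r (2 * t) + \<nu>) ` konan_initial r \<subseteq> mex_ptns r"
    using mex by (auto simp: mex_ptns_def partitions_def konan_initial_def)
qed

lemma part_le_first:
  assumes "x \<in># \<nu>"
  shows "x \<le> ith_part \<nu> 1"
  using ex_ith_part[OF assms] ith_part_antimono by (metis le_refl)

text \<open>If the largest part were \<open>r + 1\<close>, then \<open>r\<close> would be the first entry of the top row. So the partitions
  excluded from the states are not in \<open>F\<^sub>r\<close> in the first place.\<close>

lemma konan_terminal: "{x \<in> konan_states r. \<not> konan_active r x} = {0} \<times> frob_ptns r"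
proof -
  have top: "r \<in> Top \<nu>" if "r + 1 \<in># \<nu>" "\<forall>x\<in>#\<nu>. x \<le> r + 1" for \<nu>
  proof -
    have "ith_part \<nu> 1 \<in># \<nu>"
      using that(1) by (intro ith_part_in) (auto simp: Suc_le_eq nonempty_has_size[symmetric])
    then have "ith_part \<nu> 1 = r + 1" using that part_le_first by (meson antisym)
    then show ?thesis unfolding Top_iff by blast
  qed
  have "(t, \<nu>) \<in> {x \<in> konan_states r. \<not> konan_active r x} \<longleftrightarrow> (t, \<nu>) \<in> {0} \<times> frob_ptns r" for t \<nu>
    using top[of \<nu>] by (cases t) (auto simp: konan_states_def frob_ptns_def)
  then show ?thesis by (simp only: set_eq_iff split_paired_All) simp
qed

text \<open>The loop maps initial to terminal states bijectively, and these are copies of \<open>M\<^sub>r\<close> and \<open>F\<^sub>r\<close>.\<close>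

theorem konan_bij_betw: "bij_betw (konan r) (mex_ptns r) (frob_ptns r)"
  and konan_weight_eq: "\<gamma> \<in> mex_ptns r \<Longrightarrow>
    sum_mset (konan r \<gamma>) = sum_mset \<gamma> \<and> size (konan r \<gamma>) = size \<gamma>"
proof -
  let ?W = "while (konan_active r) (konan_step r)"
  have rel: "konan_rel r x (konan_step r x)" if "x \<in> konan_states r" "konan_active r x" for x
    using konan_rel_total[OF that] konan_rel_step(1) by blast
  have I: "konan_initial r \<subseteq> konan_states r" by (auto simp: konan_initial_def konan_states_def)
  have W: "konan_weight r (konan_step r x) = konan_weight r x"
    if "x \<in> konan_states r" "konan_active r x" for x
    using konan_rel_weight rel that by blast
  have loop: "bij_betw ?W (konan_initial r) ({0} \<times> frob_ptns r)"
    unfolding konan_terminal[symmetric]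
    using konan_step_bij I W finite_konan_weight by (rule while_bij_betw(1))
  have loop_weight: "konan_weight r (?W x) = konan_weight r x" if "x \<in> konan_initial r" for x
    using konan_step_bij I W finite_konan_weight that by (rule while_bij_betw(2))
  have "bij_betw snd ({0::nat} \<times> frob_ptns r) (frob_ptns r)"
    by (auto simp: bij_betw_def inj_on_def)
  from bij_betw_trans[OF bij_betw_trans[OF konan_start_bij loop] this]
  show "bij_betw (konan r) (mex_ptns r) (frob_ptns r)"
    by (simp add: comp_def konan_eq_while[abs_def])
  show "sum_mset (konan r \<gamma>) = sum_mset \<gamma> \<and> size (konan r \<gamma>) = size \<gamma>" if \<gamma>: "\<gamma> \<in> mex_ptns r"
  proof -
    obtain t where t: "mex_above r \<gamma> = r + 2 * t + 1" using \<gamma> by (rule mex_ptns_mex_above)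
    have start: "konan_start r \<gamma> \<in> konan_initial r"
      using konan_start_bij \<gamma> by (auto simp: bij_betw_def)
    then have "?W (konan_start r \<gamma>) \<in> {0} \<times> frob_ptns r"
      using bij_betw_apply[OF loop] by blast
    then have "konan_weight r (?W (konan_start r \<gamma>)) = (sum_mset (konan r \<gamma>), size (konan r \<gamma>))"
      by (auto simp: konan_weight_def konan_eq_while Delta_def)
    moreover have "konan_weight r (konan_start r \<gamma>) = (sum_mset \<gamma>, size \<gamma>)"
    proof -
      let ?D = "Delta r (2 * t)"
      have "sum_mset (?D + (\<gamma> - ?D)) = sum_mset \<gamma>" "size (?D + (\<gamma> - ?D)) = size \<gamma>"
        using konan_start_Delta(2)[OF t] by simp_all
      then show ?thesis by (simp add: konan_start_Delta(1)[OF t] konan_weight_def del: subset_mset.add_diff_inverse)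
    qed
    ultimately show ?thesis using loop_weight[OF start] by simp
  qed
qed


section \<open>Frobenius symbols determine partitions\<close>

text \<open>Conjugation as a Galois connection: both sides say that the cell in row \<open>i\<close> and column \<open>x\<close> is in the
  diagram.\<close>

lemma le_size_filter_iff:
  assumes "1 \<le> i" and "1 \<le> x"
  shows "i \<le> size {#y \<in># \<nu>. x \<le> y#} \<longleftrightarrow> x \<le> ith_part \<nu> i"
proof -
  let ?A = "{#y \<in># \<nu>. x \<le> y#}" and ?B = "{#y \<in># \<nu>. \<not> x \<le> y#}"
  have "ith_part (?A + ?B) i = (if i \<le> size ?A then ith_part ?A i else ith_part ?B (i - size ?A))"
    using assms by (intro ith_part_append) auto
  then have *: "ith_part \<nu> i = (if i \<le> size ?A then ith_part ?A i else ith_part ?B (i - size ?A))"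
    by (simp flip: multiset_partition)
  show ?thesis
  proof (cases "i \<le> size ?A")
    case True
    then show ?thesis using * ith_part_in[of i ?A] assms by simp
  next
    case False
    then have pos: "1 \<le> i - size ?A" by linarith
    have "ith_part ?B (i - size ?A) < x"
    proof (cases "i - size ?A \<le> size ?B")
      case True
      then show ?thesis using ith_part_in[OF pos, of ?B] by simp
    next
      case False
      then show ?thesis using assms by (simp add: ith_part_def)
    qed
    then show ?thesis using * False by simp
  qed
qed

lemma ith_part_conjugate:
  assumes "1 \<le> i"
  shows "ith_part (conjugate \<nu>) i = size {#x \<in># \<nu>. i \<le> x#}"
proof -
  let ?f = "\<lambda>j. size {#x \<in># \<nu>. j \<le> x#}" and ?n = "ith_part \<nu> 1"
  have mono: "?f k \<le> ?f j" if "j \<le> k" for j k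
    using that by (intro size_mset_mono filter_mset_mono_strong) auto
  have "sorted_wrt (\<ge>) (map ?f [1..<?n + 1])"
    unfolding sorted_wrt_map
    by (rule sorted_wrt_mono_rel[OF _ sorted_wrt_upt]) (use mono in auto)
  moreover have "mset (map ?f [1..<?n + 1]) = conjugate \<nu>"
    by (simp add: conjugate_def atLeastLessThanSuc_atLeastAtMost del: upt_Suc)
  ultimately have *: "parts_list (conjugate \<nu>) = map ?f [1..<?n + 1]" by (rule parts_list_eqI)
  have sz: "size (conjugate \<nu>) = ?n" by (simp add: conjugate_def)
  show ?thesis
  proof (cases "i \<le> ?n")
    case True
    then have "[1..<?n + 1] ! (i - 1) = i" using assms by (subst nth_upt) auto
    then show ?thesis unfolding ith_part_def[of "conjugate \<nu>"] * sz using True assms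
      by (simp del: upt_Suc)
  next
    case False
    then have "{#x \<in># \<nu>. i \<le> x#} = {#x \<in># \<nu>. False#}"
      using part_le_first[of _ \<nu>] by (intro filter_mset_cong) fastforce+
    then show ?thesis using False sz by (simp add: ith_part_def)
  qed
qed

lemma nat_eqI_le:
  fixes m n :: nat
  assumes "\<And>i. 1 \<le> i \<Longrightarrow> i \<le> m \<longleftrightarrow> i \<le> n"
  shows "m = n"
  using assms[of m] assms[of n] by (cases "m = 0"; cases "n = 0") auto

lemma partition_eqI:
  assumes "\<mu> \<in> partitions" "\<nu> \<in> partitions" and eq: "\<And>i. 1 \<le> i \<Longrightarrow> ith_part \<mu> i = ith_part \<nu> i"
  shows "\<mu> = \<nu>"
proof -
  have sz: "i \<le> size \<rho> \<longleftrightarrow> 1 \<le> ith_part \<rho> i" if "\<rho> \<in> partitions" "1 \<le> i" for \<rho> i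
    using that ith_part_in[of i \<rho>] by (auto simp: ith_part_def partitions_def intro!: Suc_leI gr0I)
  have size: "size \<mu> = size \<nu>"
    by (rule nat_eqI_le) (use sz assms in simp)
  have "parts_list \<mu> = parts_list \<nu>"
  proof (rule nth_equalityI)
    show "parts_list \<mu> ! k = parts_list \<nu> ! k" if "k < length (parts_list \<mu>)" for k
      using eq[of "Suc k"] that size by (simp add: ith_part_def)
  qed (use size in simp)
  then show ?thesis by (metis mset_parts_list)
qed

lemma frobenius_eq_D:
  assumes "frobenius \<mu> = frobenius \<nu>"
  shows "durfee \<mu> = durfee \<nu>"
    and "1 \<le> i \<Longrightarrow> i \<le> durfee \<nu> \<Longrightarrow> ith_part \<mu> i = ith_part \<nu> i"
    and "1 \<le> i \<Longrightarrow> i \<le> durfee \<nu> \<Longrightarrow> size {#x \<in># \<mu>. i \<le> x#} = size {#x \<in># \<nu>. i \<le> x#}"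
proof -
  have "length (fst (frobenius \<mu>)) = length (fst (frobenius \<nu>))" using assms by simp
  then show d: "durfee \<mu> = durfee \<nu>" by (simp add: frobenius_def del: upt_Suc)
  assume i: "1 \<le> i" "i \<le> durfee \<nu>"
  then have "i \<in> set [1..<durfee \<nu> + 1]" by (simp add: less_Suc_eq_le del: upt_Suc)
  then have "ith_part \<mu> i - i = ith_part \<nu> i - i"
    "ith_part (conjugate \<mu>) i - i = ith_part (conjugate \<nu>) i - i"
    using assms d unfolding frobenius_def by (simp_all del: upt_Suc)
  moreover have le: "i \<le> ith_part \<mu> i" "i \<le> ith_part \<nu> i" using i d le_durfee_iff by metis+
  moreover have "i \<le> ith_part (conjugate \<mu>) i" "i \<le> ith_part (conjugate \<nu>) i"
    using i le by (simp_all add: ith_part_conjugate le_size_filter_iff)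
  ultimately show "ith_part \<mu> i = ith_part \<nu> i"
    "size {#x \<in># \<mu>. i \<le> x#} = size {#x \<in># \<nu>. i \<le> x#}"
    using i by (auto simp: ith_part_conjugate)
qed

text \<open>The rows and the columns through the Durfee square are read off from the symbol. Every later row is no longer than
  the side of the square, so its cells lie in those columns.\<close>

lemma frobenius_inj:
  assumes "\<mu> \<in> partitions" "\<nu> \<in> partitions" and eq: "frobenius \<mu> = frobenius \<nu>"
  shows "\<mu> = \<nu>"
  using assms(1,2)
proof (rule partition_eqI)
  fix i :: nat assume i: "1 \<le> i"
  let ?d = "durfee \<nu>"
  show "ith_part \<mu> i = ith_part \<nu> i"
  proof (cases "i \<le> ?d")
    case True
    then show ?thesis using frobenius_eq_D(2)[OF eq i] by blast
  next
    case False
    have small: "ith_part \<rho> i \<le> ?d" if "durfee \<rho> = ?d" for \<rho>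
    proof -
      have "ith_part \<rho> i \<le> ith_part \<rho> (Suc ?d)" using False by (intro ith_part_antimono) auto
      then show ?thesis using le_durfee_iff[of "Suc ?d" \<rho>] that by simp
    qed
    show ?thesis
    proof (rule nat_eqI_le)
      fix x :: nat assume x: "1 \<le> x"
      show "x \<le> ith_part \<mu> i \<longleftrightarrow> x \<le> ith_part \<nu> i"
      proof (cases "x \<le> ?d")
        case True
        then show ?thesis
          using frobenius_eq_D(3)[OF eq x] le_size_filter_iff[OF i x] by metis
      next
        case False
        then show ?thesis
          using small[of \<mu>] small[of \<nu>] frobenius_eq_D(1)[OF eq] by auto
      qed
    qed
  qed
qed


section \<open>The maps U and B\<close>

text \<open>The diagonal part of the cut at level \<open>r - 1\<close> is the row with arm \<open>r - 1\<close>. No earlier row has arm \<open>r\<close>, hence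
  all earlier rows are long enough for this row to grow by one cell.\<close>

lemma U_map_decompose:
  assumes "1 \<le> r" and "r \<notin> Top \<nu>" and "r - 1 \<in> Top \<nu>"
  obtains A B where "\<nu> = A + ({#r + size A#} + B)"
    and "\<And>a. a \<in># A \<Longrightarrow> r + size A < a" and "\<And>b. b \<in># B \<Longrightarrow> b \<le> r + size A"
proof -
  obtain A' B where \<nu>: "\<nu> = A' + B" and c: "staircase_cut (r - 1) A' B" using ex_staircase_cut by blast
  have "r - 1 + size A' \<in># A'" using Top_staircase_cut[OF c] \<nu> assms(3) by simp
  then obtain A where A: "A' = A + {#r - 1 + size A'#}" by (metis add_mset_add_single mset_add)
  then have "size A' = Suc (size A)" by (metis add_mset_add_single size_add_mset)
  then have A: "A' = A + {#r + size A#}" and sz: "r - 1 + size A' = r + size A"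
    using A assms(1) by auto
  have le: "r + size A \<le> a" if "a \<in># A" for a
    using staircase_cutD(1)[OF c, of a] that sz A by simp
  have B: "b \<le> r + size A" if "b \<in># B" for b
    using staircase_cutD(2)[OF c, of b] that sz by simp
  have "staircase_cut r A ({#r + size A#} + B)"
    using le B by (auto simp: staircase_cut_def)
  from Top_staircase_cut[OF this] have "r + size A \<notin># A"
    using assms(2) \<nu> A by (simp add: ac_simps)
  then have "r + size A < a" if "a \<in># A" for a
    using le[OF that] that by (metis le_neq_implies_less)
  then show ?thesis using that[of A B] B \<nu> A by (simp add: ac_simps)
qed

text \<open>The new cell lies in row \<open>size A + 1\<close> and column \<open>r + size A + 1\<close>. Only the \<open>size A\<close> rows above
  reach that column, so it lies to the right of the Durfee square, while the row itself already runs through the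
  square. The square and all its columns remain unchanged, and only the arm of that row grows.\<close>

lemma frobenius_increment:
  assumes "1 \<le> r" and A: "\<And>a. a \<in># A \<Longrightarrow> r + size A < a" and B: "\<And>b. b \<in># B \<Longrightarrow> b \<le> r + size A"
  defines "\<nu> \<equiv> A + ({#r + size A#} + B)" and "\<mu> \<equiv> A + ({#Suc (r + size A)#} + B)"
  shows "frobenius \<mu> =
    (map (\<lambda>a. if a = r - 1 then r else a) (fst (frobenius \<nu>)), snd (frobenius \<nu>))"
proof -
  have parts: "ith_part (A + ({#x#} + B)) i =
      (if i \<le> size A then ith_part A i else if i = Suc (size A) then x
       else ith_part B (i - Suc (size A)))"
    if "1 \<le> i" "x = r + size A \<or> x = Suc (r + size A)" for i x
  proof -
    have "ith_part (A + ({#x#} + B)) i =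
        (if i \<le> size A then ith_part A i else ith_part ({#x#} + B) (i - size A))"
      using that A B by (intro ith_part_append) fastforce+
    moreover have "ith_part ({#x#} + B) j = (if j \<le> 1 then x else ith_part B (j - 1))"
      if "1 \<le> j" for j
    proof -
      have "ith_part {#x#} 1 = x" using ith_part_in[of 1 "{#x#}"] by simp
      moreover have "ith_part ({#x#} + B) j = (if j \<le> size {#x#} then ith_part {#x#} j
          else ith_part B (j - size {#x#}))"
        using that \<open>x = _ \<or> _\<close> B by (intro ith_part_append) fastforce+
      ultimately show ?thesis using that by (auto simp: le_Suc_eq)
    qed
    ultimately show ?thesis using that by auto
  qed
  have \<nu>_small: "ith_part \<nu> i \<le> r + size A" if "Suc (size A) < i" for i
  proof -
    have "ith_part \<nu> i = ith_part B (i - Suc (size A))" 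
      using that parts[of i "r + size A"] by (simp add: \<nu>_def)
    moreover have "ith_part B (i - Suc (size A)) \<le> r + size A"
    proof (cases "i - Suc (size A) \<le> size B")
      case True
      then show ?thesis using that by (intro B ith_part_in) auto
    qed (simp add: ith_part_def)
    ultimately show ?thesis by simp
  qed
  have \<nu>_large: "r + size A < ith_part \<nu> i" if "1 \<le> i" "i \<le> size A" for i
    using that ith_part_in[of i A] A parts[of i "r + size A"] by (simp add: \<nu>_def)
  have \<nu>_at: "ith_part \<nu> (Suc (size A)) = r + size A"
    using parts[of "Suc (size A)" "r + size A"] by (simp add: \<nu>_def)
  have \<mu>_part: "ith_part \<mu> i = (if i = Suc (size A) then Suc (r + size A) else ith_part \<nu> i)"
    if "1 \<le> i" for i
    using that parts[of i "r + size A"] parts[of i "Suc (r + size A)"] by (simp add: \<nu>_def \<mu>_def)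
  have "i \<le> durfee \<mu> \<longleftrightarrow> i \<le> durfee \<nu>" if "1 \<le> i" for i
    using that assms(1) by (simp add: le_durfee_iff \<mu>_part \<nu>_at)
  then have d: "durfee \<mu> = durfee \<nu>"
    by (rule nat_eqI_le)
  have "\<not> Suc (r + size A) \<le> durfee \<nu>"
    using \<nu>_small[of "Suc (r + size A)"] assms(1) by (simp add: le_durfee_iff)
  then have d_le: "durfee \<nu> \<le> r + size A" by simp
  have arm: "ith_part \<mu> i - i = (if ith_part \<nu> i - i = r - 1 then r else ith_part \<nu> i - i)"
    if "1 \<le> i" "i \<le> durfee \<nu>" for i
  proof -
    have "i \<le> ith_part \<nu> i" using that le_durfee_iff by blast
    then show ?thesis
      using \<nu>_small[of i] \<nu>_large[of i] \<nu>_at \<mu>_part[of i] that(1) assms(1)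
      by (cases i "Suc (size A)" rule: linorder_cases) auto
  qed
  have leg: "ith_part (conjugate \<mu>) i = ith_part (conjugate \<nu>) i"
    if "1 \<le> i" "i \<le> durfee \<nu>" for i
    using that d_le by (simp add: ith_part_conjugate \<mu>_def \<nu>_def)
  show ?thesis
    unfolding frobenius_def d by (auto simp: arm leg simp del: upt_Suc)
qed

lemma U_map_props:
  assumes "1 \<le> r" and \<nu>: "\<nu> \<in> frob_ptns r" and "r - 1 \<in> Top \<nu>"
  shows "U_map r \<nu> \<in> partitions"
    and "frobenius (U_map r \<nu>) =
      (map (\<lambda>a. if a = r - 1 then r else a) (fst (frobenius \<nu>)), snd (frobenius \<nu>))"
    and "sum_mset (U_map r \<nu>) = Suc (sum_mset \<nu>)"
    and "size (U_map r \<nu>) = size \<nu>"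
proof -
  let ?P = "\<lambda>\<mu>. \<mu> \<in> partitions \<and> frobenius \<mu> =
      (map (\<lambda>a. if a = r - 1 then r else a) (fst (frobenius \<nu>)), snd (frobenius \<nu>))"
  obtain A B where AB: "\<nu> = A + ({#r + size A#} + B)"
    "\<And>a. a \<in># A \<Longrightarrow> r + size A < a" "\<And>b. b \<in># B \<Longrightarrow> b \<le> r + size A"
    using U_map_decompose[of r \<nu>] assms by (auto simp: frob_ptns_def)
  let ?\<mu> = "A + ({#Suc (r + size A)#} + B)"
  have P: "?P ?\<mu>"
    using frobenius_increment[OF assms(1) AB(2,3)] AB(1) \<nu> by (auto simp: frob_ptns_def partitions_def)
  then have "U_map r \<nu> = ?\<mu>"
    unfolding U_map_def by (rule the_equality) (use P frobenius_inj in metis)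
  then show "U_map r \<nu> \<in> partitions"
    "frobenius (U_map r \<nu>) =
      (map (\<lambda>a. if a = r - 1 then r else a) (fst (frobenius \<nu>)), snd (frobenius \<nu>))"
    "sum_mset (U_map r \<nu>) = Suc (sum_mset \<nu>)" "size (U_map r \<nu>) = size \<nu>"
    using P AB(1) by simp_all
qed

lemma U_map_Top:
  assumes "1 \<le> r" and "\<nu> \<in> frob_ptns r" and "r - 1 \<in> Top \<nu>"
  shows "r \<in> Top (U_map r \<nu>)" and "r - 1 \<notin> Top (U_map r \<nu>)"
  using assms unfolding Top_def U_map_props(2)[OF assms] by auto

lemma U_map_inj:
  assumes "1 \<le> r" and "\<nu> \<in> frob_ptns r" "r - 1 \<in> Top \<nu>" and "\<nu>' \<in> frob_ptns r" "r - 1 \<in> Top \<nu>'"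
    and eq: "U_map r \<nu> = U_map r \<nu>'"
  shows "\<nu> = \<nu>'"
proof (rule frobenius_inj)
  let ?f = "\<lambda>a. if a = r - 1 then r else a"
  \<comment> \<open>Raising \<open>r - 1\<close> to \<open>r\<close> can be undone because \<open>r\<close> is not yet in the top row.\<close>
  have "inj_on ?f (Top \<nu> \<union> Top \<nu>')"
    using assms by (auto simp: inj_on_def frob_ptns_def)
  moreover have "map ?f (fst (frobenius \<nu>)) = map ?f (fst (frobenius \<nu>'))"
    "snd (frobenius \<nu>) = snd (frobenius \<nu>')"
    using U_map_props(2)[OF assms(1-3)] U_map_props(2)[OF assms(1,4,5)] eq by simp_all
  ultimately show "frobenius \<nu> = frobenius \<nu>'"
    by (simp add: Top_def inj_on_map_eq_map prod_eq_iff)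
qed (use assms in \<open>auto simp: frob_ptns_def\<close>)

lemma B_map_in:
  assumes "2 \<le> r" and "\<alpha> \<in> partitions" and "\<nu> \<in> frob_ptns r" and "B_map r (\<alpha>, m, \<nu>) = (\<alpha>', \<mu>)"
  shows "\<alpha>' \<in> partitions" and "\<mu> \<in> frob_ptns (r - 1)"
    and "sum_mset \<alpha>' + sum_mset \<mu> = sum_mset \<alpha> + sum_mset \<nu> + r"
    and "size \<alpha>' = Suc (size \<alpha>)" and "size \<mu> = size \<nu>"
  using assms U_map_props[of r \<nu>] U_map_Top[of r \<nu>]
  by (auto simp: B_map_def partitions_def frob_ptns_def split: if_splits)

text \<open>The case of the definition can be recovered from the image: only \<open>U_map r\<close> produces \<open>r\<close> in the top row.\<close>

lemma B_map_inj:
  assumes "1 \<le> r" and "\<nu> \<in> frob_ptns r" and "\<nu>' \<in> frob_ptns r"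
    and eq: "B_map r (\<alpha>, m, \<nu>) = B_map r (\<alpha>', m', \<nu>')"
  shows "\<alpha> = \<alpha>' \<and> \<nu> = \<nu>'"
proof (cases "r - 1 \<in> Top \<nu>"; cases "r - 1 \<in> Top \<nu>'")
  assume "r - 1 \<in> Top \<nu>" "r - 1 \<in> Top \<nu>'"
  then show ?thesis using U_map_inj[of r \<nu> \<nu>'] assms by (auto simp: B_map_def)
next
  assume t: "r - 1 \<in> Top \<nu>" "r - 1 \<notin> Top \<nu>'"
  then have "U_map r \<nu> = \<nu>'" using eq by (simp add: B_map_def)
  then show ?thesis using U_map_Top(1)[of r \<nu>] assms t by (auto simp: frob_ptns_def)
next
  assume t: "r - 1 \<notin> Top \<nu>" "r - 1 \<in> Top \<nu>'"
  then have "\<nu> = U_map r \<nu>'" using eq by (simp add: B_map_def)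
  then show ?thesis using U_map_Top(1)[of r \<nu>'] assms t by (auto simp: frob_ptns_def)
next
  assume "r - 1 \<notin> Top \<nu>" "r - 1 \<notin> Top \<nu>'"
  then show ?thesis using eq by (auto simp: B_map_def)
qed


section \<open>The injection and the generating functions\<close>

text \<open>A mex above \<open>r\<close> forces the parts \<open>1, \<dots>, r\<close>. Removing one copy of each changes no multiplicity above \<open>r\<close>, so
  the mex of \<open>\<beta>\<close> becomes $\mathrm{mex}_r$ of the rest.\<close>

lemma C_pairs_iff:
  "(\<alpha>, \<beta>) \<in> C_pairs r \<longleftrightarrow> \<alpha> \<in> partitions \<and> (\<exists>\<gamma> \<in> mex_ptns r. \<beta> = staircase r + \<gamma>)"
proof -
  have mex: "mex \<beta> = mex_above 0 \<beta>" for \<beta>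
    by (simp add: mex_def mex_above_def Suc_le_eq)
  have stair: "staircase r = Delta 0 r" by (simp add: staircase_def Delta_def)
  have "\<beta> \<in> partitions \<and> (\<exists>d. mex \<beta> = r + 2 * d + 1) \<longleftrightarrow> (\<exists>\<gamma> \<in> mex_ptns r. \<beta> = staircase r + \<gamma>)"
  proof
    assume \<beta>: "\<beta> \<in> partitions \<and> (\<exists>d. mex \<beta> = r + 2 * d + 1)"
    then obtain d where d: "mex_above 0 \<beta> = r + 2 * d + 1" by (auto simp: mex)
    let ?\<gamma> = "\<beta> - staircase r"
    have "staircase r \<subseteq># \<beta>"
      using below_mex_above[of 0 _ \<beta>] d by (auto simp: stair Delta_subseteq_iff)
    then have eq: "\<beta> = staircase r + ?\<gamma>" by simp
    have in_iff: "t \<in># ?\<gamma> \<longleftrightarrow> t \<in># \<beta>" if "r < t" for t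
      using that by (subst (2) eq) (simp add: stair)
    have "mex_above r ?\<gamma> = r + 2 * d + 1"
    proof (rule mex_above_eqI)
      show "r + 2 * d + 1 \<notin># ?\<gamma>" using in_iff mex_above_notin[of 0 \<beta>] d by simp
      show "t \<in># ?\<gamma>" if "r < t" "t < r + 2 * d + 1" for t
        using in_iff below_mex_above[of 0 t \<beta>] d that by simp
    qed simp
    then have "?\<gamma> \<in> mex_ptns r"
      using \<beta> by (auto simp: mex_ptns_def partitions_def dest: in_diffD)
    then show "\<exists>\<gamma> \<in> mex_ptns r. \<beta> = staircase r + \<gamma>" using eq by blast
  next
    assume "\<exists>\<gamma> \<in> mex_ptns r. \<beta> = staircase r + \<gamma>"
    then obtain \<gamma> where \<gamma>: "\<gamma> \<in> mex_ptns r" "\<beta> = staircase r + \<gamma>" by blast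
    obtain d where d: "mex_above r \<gamma> = r + 2 * d + 1" using \<gamma>(1) by (rule mex_ptns_mex_above)
    have "mex_above 0 \<beta> = r + 2 * d + 1"
    proof (rule mex_above_eqI)
      show "r + 2 * d + 1 \<notin># \<beta>" using \<gamma> mex_above_notin[of r \<gamma>] d by (simp add: stair)
      show "t \<in># \<beta>" if "0 < t" "t < r + 2 * d + 1" for t
        using that below_mex_above[of r t \<gamma>] d \<gamma>(2) by (cases "r < t") (auto simp: stair)
    qed simp
    then show "\<beta> \<in> partitions \<and> (\<exists>d. mex \<beta> = r + 2 * d + 1)"
      using \<gamma> by (auto simp: mex partitions_def mex_ptns_def stair)
  qed
  then show ?thesis by (auto simp: C_pairs_def)
qed

lemma lookup_sum_zpow:
  assumes "finite A"
  shows "Poly_Mapping.lookup (\<Sum>x\<in>A. zpow (e x)) k = int (card {x \<in> A. e x = k})"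
proof -
  have "Poly_Mapping.lookup (\<Sum>x\<in>A. zpow (e x)) k = (\<Sum>x\<in>A. if e x = k then 1 else 0)"
    by (auto simp: lookup_sum zpow_def lookup_single when_def intro!: sum.cong)
  also have "\<dots> = int (card {x \<in> A. e x = k})"
    using assms by (simp add: sum.inter_filter[symmetric])
  finally show ?thesis .
qed

definition C_pairs_coeff :: "nat \<Rightarrow> nat \<Rightarrow> int \<Rightarrow> (ptn \<times> ptn) set" where
  "C_pairs_coeff r n k = {(\<alpha>, \<beta>) \<in> C_pairs r.
     sum_mset \<alpha> + sum_mset \<beta> = n \<and> int (size \<alpha>) - int (size \<beta>) = k}"

lemma lookup_zpow_mult_C_series:
  "Poly_Mapping.lookup (fps_nth (fps_const (zpow j) * C_series r) n) k =
     int (card (C_pairs_coeff r n (k - j)))"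
proof -
  let ?A = "{(\<alpha>, \<beta>) \<in> C_pairs r. sum_mset \<alpha> + sum_mset \<beta> = n}"
  let ?e = "\<lambda>(\<alpha>::ptn, \<beta>::ptn). int (size \<alpha>) - int (size \<beta>)"
  have "fps_nth (fps_const (zpow j) * C_series r) n = zpow j * (\<Sum>x\<in>?A. zpow (?e x))"
    by (simp add: C_series_def case_prod_unfold)
  also have "\<dots> = (\<Sum>x\<in>?A. zpow (j + ?e x))"
    by (simp add: sum_distrib_left zpow_def mult_single)
  also have "Poly_Mapping.lookup \<dots> k = int (card {x \<in> ?A. j + ?e x = k})"
    by (rule lookup_sum_zpow) (rule finite_C_pairs_size)
  also have "{x \<in> ?A. j + ?e x = k} = C_pairs_coeff r n (k - j)"
    by (auto simp: C_pairs_coeff_def)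
  finally show ?thesis .
qed

lemma finite_C_pairs_coeff: "finite (C_pairs_coeff r n k)"
  by (rule finite_subset[OF _ finite_C_pairs_size[of r n]]) (auto simp: C_pairs_coeff_def)

lemma lookup_C_series:
  "Poly_Mapping.lookup (fps_nth (C_series r) n) k = int (card (C_pairs_coeff r n k))"
proof -
  have "fps_const (zpow 0) = 1" by (simp add: zpow_def)
  then show ?thesis using lookup_zpow_mult_C_series[of 0 r n k] by simp
qed

lemma zpow_mult_C_series_le:
  assumes inj: "inj_on f (C_pairs r)"
    and f: "\<And>\<alpha> \<beta>. (\<alpha>, \<beta>) \<in> C_pairs r \<Longrightarrow> \<exists>\<alpha>' \<beta>'. f (\<alpha>, \<beta>) = (\<alpha>', \<beta>') \<and> (\<alpha>', \<beta>') \<in> C_pairs r' \<and>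
      sum_mset \<alpha>' + sum_mset \<beta>' = sum_mset \<alpha> + sum_mset \<beta> \<and>
      int (size \<alpha>') - int (size \<beta>') = int (size \<alpha>) - int (size \<beta>) + j"
  shows "fps_const (zpow j) * C_series r \<preceq> C_series r'"
proof -
  have "card (C_pairs_coeff r n (k - j)) \<le> card (C_pairs_coeff r' n k)" for n k
  proof (rule card_inj_on_le)
    show "inj_on f (C_pairs_coeff r n (k - j))"
      using inj by (rule inj_on_subset) (auto simp: C_pairs_coeff_def)
    show "f ` C_pairs_coeff r n (k - j) \<subseteq> C_pairs_coeff r' n k"
      using f by (fastforce simp: C_pairs_coeff_def)
  qed (rule finite_C_pairs_coeff)
  then show ?thesis
    unfolding coeff_le_def
    by (simp add: lookup_minus lookup_zpow_mult_C_series lookup_C_series del: fps_mult_left_const_nth)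
qed

definition Theta :: "nat \<Rightarrow> ptn \<times> ptn \<Rightarrow> ptn \<times> ptn" where
  "Theta r = (\<lambda>(\<alpha>, \<beta>).
     let (\<alpha>', \<mu>) = B_map r (\<alpha>, Marked r, konan r (\<beta> - staircase r))
     in (\<alpha>', staircase (r - 1) + konan_inv (r - 1) \<mu>))"

lemma konan_inv_props:
  assumes "\<mu> \<in> frob_ptns r"
  shows "konan_inv r \<mu> \<in> mex_ptns r" and "konan r (konan_inv r \<mu>) = \<mu>"
  using konan_bij_betw[of r] assms unfolding konan_inv_def bij_betw_def
  by (auto intro: the_inv_into_into f_the_inv_into_f)

lemma Theta_props:
  assumes "2 \<le> r" and "(\<alpha>, \<beta>) \<in> C_pairs r"
  shows "\<exists>\<gamma> \<nu> \<alpha>' \<mu> \<gamma>' \<beta>'.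
    \<beta> = staircase r + \<gamma> \<and> \<gamma> \<in> mex_ptns r \<and>
    \<nu> = konan r \<gamma> \<and> \<nu> \<in> frob_ptns r \<and>
    B_map r (\<alpha>, Marked r, \<nu>) = (\<alpha>', \<mu>) \<and> \<mu> \<in> frob_ptns (r - 1) \<and>
    \<gamma>' = konan_inv (r - 1) \<mu> \<and> \<gamma>' \<in> mex_ptns (r - 1) \<and> konan (r - 1) \<gamma>' = \<mu> \<and>
    \<beta>' = staircase (r - 1) + \<gamma>' \<and>
    Theta r (\<alpha>, \<beta>) = (\<alpha>', \<beta>') \<and> (\<alpha>', \<beta>') \<in> C_pairs (r - 1) \<and>
    sum_mset \<alpha>' + sum_mset \<beta>' = sum_mset \<alpha> + sum_mset \<beta> \<and>
    int (size \<alpha>') - int (size \<beta>') = int (size \<alpha>) - int (size \<beta>) + 2"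
proof -
  obtain \<gamma> where \<alpha>: "\<alpha> \<in> partitions" and \<gamma>: "\<gamma> \<in> mex_ptns r" "\<beta> = staircase r + \<gamma>"
    using assms(2) unfolding C_pairs_iff by blast
  let ?\<nu> = "konan r \<gamma>"
  obtain \<alpha>' \<mu> where B: "B_map r (\<alpha>, Marked r, ?\<nu>) = (\<alpha>', \<mu>)" by force
  let ?\<gamma>' = "konan_inv (r - 1) \<mu>"
  have \<nu>: "?\<nu> \<in> frob_ptns r" using konan_bij_betw \<gamma>(1) by (auto simp: bij_betw_def)
  note b = B_map_in[OF assms(1) \<alpha> \<nu> B]
  note \<gamma>' = konan_inv_props[OF b(2)]
  have w: "sum_mset ?\<gamma>' = sum_mset \<mu>" "size ?\<gamma>' = size \<mu>"
    using konan_weight_eq[OF \<gamma>'(1)] \<gamma>'(2) by auto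
  have stair: "staircase r = staircase (r - 1) + {#r#}"
    using Delta_Suc[of 0 "r - 1"] assms(1) by (simp add: staircase_def Delta_def)
  have sz: "size (staircase n) = n" for n by (simp add: staircase_def)
  have "Theta r (\<alpha>, \<beta>) = (\<alpha>', staircase (r - 1) + ?\<gamma>')" by (simp add: Theta_def \<gamma>(2) B)
  moreover have "(\<alpha>', staircase (r - 1) + ?\<gamma>') \<in> C_pairs (r - 1)"
    using b(1) \<gamma>'(1) unfolding C_pairs_iff by blast
  moreover have "sum_mset \<alpha>' + sum_mset (staircase (r - 1) + ?\<gamma>') = sum_mset \<alpha> + sum_mset \<beta>"
    using b(3) w konan_weight_eq[OF \<gamma>(1)] by (simp add: \<gamma>(2) stair)
  moreover have "int (size \<alpha>') - int (size (staircase (r - 1) + ?\<gamma>')) =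
      int (size \<alpha>) - int (size \<beta>) + 2"
    using b(4,5) w konan_weight_eq[OF \<gamma>(1)] assms(1) by (simp add: \<gamma>(2) sz of_nat_diff)
  ultimately show ?thesis using \<gamma> \<nu> B b(2) \<gamma>' by blast
qed

lemma Theta_inj:
  assumes "2 \<le> r"
  shows "inj_on (Theta r) (C_pairs r)"
proof (rule inj_onI)
  fix x y assume xy: "x \<in> C_pairs r" "y \<in> C_pairs r" "Theta r x = Theta r y"
  obtain \<alpha>1 \<beta>1 \<alpha>2 \<beta>2 where x: "x = (\<alpha>1, \<beta>1)" and y: "y = (\<alpha>2, \<beta>2)" by (cases x, cases y) auto
  obtain \<gamma>1 \<alpha>1' \<mu>1 where 1: "\<beta>1 = staircase r + \<gamma>1" "\<gamma>1 \<in> mex_ptns r" "konan r \<gamma>1 \<in> frob_ptns r"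
    "B_map r (\<alpha>1, Marked r, konan r \<gamma>1) = (\<alpha>1', \<mu>1)" "konan (r - 1) (konan_inv (r - 1) \<mu>1) = \<mu>1"
    "Theta r x = (\<alpha>1', staircase (r - 1) + konan_inv (r - 1) \<mu>1)"
    using Theta_props[OF assms xy(1)[unfolded x]] unfolding x by blast
  obtain \<gamma>2 \<alpha>2' \<mu>2 where 2: "\<beta>2 = staircase r + \<gamma>2" "\<gamma>2 \<in> mex_ptns r" "konan r \<gamma>2 \<in> frob_ptns r"
    "B_map r (\<alpha>2, Marked r, konan r \<gamma>2) = (\<alpha>2', \<mu>2)" "konan (r - 1) (konan_inv (r - 1) \<mu>2) = \<mu>2"
    "Theta r y = (\<alpha>2', staircase (r - 1) + konan_inv (r - 1) \<mu>2)"
    using Theta_props[OF assms xy(2)[unfolded y]] unfolding y by blast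
  have "\<alpha>1' = \<alpha>2'" "konan_inv (r - 1) \<mu>1 = konan_inv (r - 1) \<mu>2"
    using xy(3) 1(6) 2(6) by simp_all
  then have "\<mu>1 = \<mu>2" using 1(5) 2(5) by metis
  then have "\<alpha>1 = \<alpha>2 \<and> konan r \<gamma>1 = konan r \<gamma>2"
    using \<open>\<alpha>1' = \<alpha>2'\<close> 1(3,4) 2(3,4) assms by (intro B_map_inj[of r _ _ _ "Marked r" _ "Marked r"]) auto
  moreover from this have "\<gamma>1 = \<gamma>2"
    using konan_bij_betw[of r] 1(2) 2(2) by (auto simp: bij_betw_def inj_on_def)
  ultimately show "x = y" using 1(1) 2(1) x y by simp
qed

theorem theorem4p3:
  fixes r :: nat
  assumes "2 \<le> r"
  shows "(\<exists>\<Theta> :: (atom \<times> atom) \<times> (ptn \<times> ptn) \<Rightarrow> ptn \<times> ptn.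
      inj_on \<Theta> ({(U, U)} \<times> C_pairs r) \<and>
      \<Theta> ` ({(U, U)} \<times> C_pairs r) \<subseteq> C_pairs (r - 1) \<and>
      (\<forall>\<alpha> \<beta>. (\<alpha>, \<beta>) \<in> C_pairs r \<longrightarrow>
        (\<exists>\<gamma> \<nu> \<alpha>' \<mu> \<gamma>' \<beta>'.
          \<beta> = staircase r + \<gamma> \<and> \<gamma> \<in> mex_ptns r \<and>
          \<nu> = konan r \<gamma> \<and> \<nu> \<in> frob_ptns r \<and>
          B_map r (\<alpha>, Marked r, \<nu>) = (\<alpha>', \<mu>) \<and> \<mu> \<in> frob_ptns (r - 1) \<and>
          \<gamma>' = konan_inv (r - 1) \<mu> \<and> \<gamma>' \<in> mex_ptns (r - 1) \<and> konan (r - 1) \<gamma>' = \<mu> \<and>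
          \<beta>' = staircase (r - 1) + \<gamma>' \<and>
          \<Theta> ((U, U), (\<alpha>, \<beta>)) = (\<alpha>', \<beta>') \<and>
          sum_mset \<alpha>' + sum_mset \<beta>' = sum_mset \<alpha> + sum_mset \<beta> \<and>
          int (size \<alpha>') - int (size \<beta>') = int (size \<alpha>) - int (size \<beta>) + 2)))
    \<and> fps_const (zpow 2) * C_series r \<preceq> C_series (r - 1)"
proof
  show "fps_const (zpow 2) * C_series r \<preceq> C_series (r - 1)"
    using Theta_inj[OF assms] by (rule zpow_mult_C_series_le) (use Theta_props[OF assms] in blast)
  let ?\<Theta> = "\<lambda>x :: (atom \<times> atom) \<times> (ptn \<times> ptn). Theta r (snd x)"
  have "inj_on ?\<Theta> ({(U, U)} \<times> C_pairs r)"
    using Theta_inj[OF assms] by (auto simp: inj_on_def)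
  moreover have "?\<Theta> ` ({(U, U)} \<times> C_pairs r) \<subseteq> C_pairs (r - 1)"
    using Theta_props[OF assms] by fastforce
  moreover note Theta_props[OF assms]
  ultimately show "\<exists>\<Theta> :: (atom \<times> atom) \<times> (ptn \<times> ptn) \<Rightarrow> ptn \<times> ptn.
      inj_on \<Theta> ({(U, U)} \<times> C_pairs r) \<and>
      \<Theta> ` ({(U, U)} \<times> C_pairs r) \<subseteq> C_pairs (r - 1) \<and>
      (\<forall>\<alpha> \<beta>. (\<alpha>, \<beta>) \<in> C_pairs r \<longrightarrow>
        (\<exists>\<gamma> \<nu> \<alpha>' \<mu> \<gamma>' \<beta>'.
          \<beta> = staircase r + \<gamma> \<and> \<gamma> \<in> mex_ptns r \<and>
          \<nu> = konan r \<gamma> \<and> \<nu> \<in> frob_ptns r \<and>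
          B_map r (\<alpha>, Marked r, \<nu>) = (\<alpha>', \<mu>) \<and> \<mu> \<in> frob_ptns (r - 1) \<and>
          \<gamma>' = konan_inv (r - 1) \<mu> \<and> \<gamma>' \<in> mex_ptns (r - 1) \<and> konan (r - 1) \<gamma>' = \<mu> \<and>
          \<beta>' = staircase (r - 1) + \<gamma>' \<and>
          \<Theta> ((U, U), (\<alpha>, \<beta>)) = (\<alpha>', \<beta>') \<and>
          sum_mset \<alpha>' + sum_mset \<beta>' = sum_mset \<alpha> + sum_mset \<beta> \<and>
          int (size \<alpha>') - int (size \<beta>') = int (size \<alpha>) - int (size \<beta>) + 2))"
    by (intro exI[of _ ?\<Theta>]) (simp, blast)
qed

end
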